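(* The following problem is undecidable: given two polynomials $p,q\in\mathbf{P}[X_1,\ldots,X_m]$ (polynomials in finitely many variables with coefficients in $\mathbf{P}$), decide whether the equation $p(\vec X)=q(\vec X)$ has a solution in $\mathbf{P}^m$.
   Context: A profile is a sequence $\mathbf{p}=(p_i)_{i\in\mathbb{N}}$ of natural numbers for which there exists $h\ge -1$ with $p_i\ge 1$ for $0\le i\le h$ and $p_i=0$ for $i>h$ (the null sequence $(0)$ is a profile). $\mathbf{P}$ is the set of profiles; it is a commutative semiring with elementwise sum and product $(\mathbf{p}\times\mathbf{q})_i = p_i\sum_{j=0}^i q_j + q_i\sum_{j=0}^i p_j - p_i q_i$, zero $(0)$ and one $(1)=(1,0,0,\ldots)$. Profiles are encoded as the finite sequence of their nonzero terms, each in binary. *)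

theory Defs
  imports "HOL-Library.Poly_Mapping" "HOL-Library.Nat_Bijection"
begin
definition is_profile :: "(nat \<Rightarrow> nat) \<Rightarrow> bool" where
  "is_profile p \<longleftrightarrow>
    (\<exists>h::int. h \<ge> - 1 \<and> (\<forall>i. int i \<le> h \<longrightarrow> p i \<ge> 1) \<and> (\<forall>i. int i > h \<longrightarrow> p i = 0))"

lemma is_profile_iff: "is_profile p \<longleftrightarrow> (\<exists>n. \<forall>i. 0 < p i \<longleftrightarrow> i < n)"
proof
  assume "is_profile p"
  then obtain h :: int where h: "h \<ge> - 1" "\<forall>i. int i \<le> h \<longrightarrow> p i \<ge> 1" "\<forall>i. int i > h \<longrightarrow> p i = 0"
    unfolding is_profile_def by blast
  have "0 < p i \<longleftrightarrow> i < nat (h + 1)" for i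
  proof (cases "int i \<le> h")
    case True
    then show ?thesis using h(2) by (simp add: Suc_le_eq zless_nat_eq_int_zless)
  next
    case False
    then show ?thesis using h(3) by (simp add: zless_nat_eq_int_zless)
  qed
  then show "\<exists>n. \<forall>i. 0 < p i \<longleftrightarrow> i < n" by blast
next
  assume "\<exists>n. \<forall>i. 0 < p i \<longleftrightarrow> i < n"
  then obtain n where n: "\<And>i. 0 < p i \<longleftrightarrow> i < n" by blast
  have "int i \<le> int n - 1 \<Longrightarrow> p i \<ge> 1" for i
    using n[of i] by linarith
  moreover have "int i > int n - 1 \<Longrightarrow> p i = 0" for i
    using n[of i] by linarith
  ultimately show "is_profile p"
    unfolding is_profile_def by (intro exI[of _ "int n - 1"]) auto
qed

typedef profile = "{p. is_profile p}"
  morphisms profile_nth Abs_profile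
proof
  show "(\<lambda>_. 0) \<in> {p. is_profile p}" by (auto simp: is_profile_iff)
qed

setup_lifting type_definition_profile

text \<open>The subtraction in the product is on natural numbers, but never truncates.\<close>

definition profile_times :: "(nat \<Rightarrow> nat) \<Rightarrow> (nat \<Rightarrow> nat) \<Rightarrow> nat \<Rightarrow> nat" where
  "profile_times p q i = p i * (\<Sum>j = 0..i. q j) + q i * (\<Sum>j = 0..i. p j) - p i * q i"

text \<open>Partial sums turn the product of profiles into the pointwise product.\<close>

lemma sum_profile_times:
  "(\<Sum>j = 0..i. profile_times p q j) = (\<Sum>j = 0..i. p j) * (\<Sum>j = 0..i. q j)"
proof (induction i)
  case 0
  then show ?case by (simp add: profile_times_def)
next
  case (Suc i)
  then show ?case by (simp add: profile_times_def algebra_simps)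
qed

lemma partial_sums_eqI:
  fixes p q :: "nat \<Rightarrow> nat"
  assumes "\<And>i. (\<Sum>j = 0..i. p j) = (\<Sum>j = 0..i. q j)"
  shows "p = q"
proof
  fix i
  show "p i = q i"
    using assms[of i] assms[of "i - 1"] by (cases i) simp_all
qed

lemma profile_times_pos_iff:
  "0 < profile_times p q i \<longleftrightarrow>
    (0 < p i \<and> 0 < (\<Sum>j = 0..i. q j)) \<or> (0 < q i \<and> 0 < (\<Sum>j = 0..i. p j))"
proof -
  define P where "P = (\<Sum>j = 0..<i. p j)"
  define Q where "Q = (\<Sum>j = 0..<i. q j)"
  have *: "(\<Sum>j = 0..i. p j) = P + p i" "(\<Sum>j = 0..i. q j) = Q + q i"
    unfolding P_def Q_def by (simp_all add: atLeastLessThanSuc_atLeastAtMost[symmetric])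
  show ?thesis
    unfolding profile_times_def * by (auto simp: algebra_simps)
qed

lemma is_profile_times:
  assumes "is_profile p" "is_profile q"
  shows "is_profile (profile_times p q)"
proof -
  obtain m where m: "\<And>i. 0 < p i \<longleftrightarrow> i < m" using assms by (auto simp: is_profile_iff)
  obtain n where n: "\<And>i. 0 < q i \<longleftrightarrow> i < n" using assms by (auto simp: is_profile_iff)
  have sum_pos: "0 < (\<Sum>j = 0..i. r j) \<longleftrightarrow> 0 < k" if r: "\<And>i. 0 < r i \<longleftrightarrow> i < k"
    for r :: "nat \<Rightarrow> nat" and k i
  proof (cases "0 < k")
    case True
    then have "0 < r 0" using r by simp
    also have "r 0 \<le> (\<Sum>j = 0..i. r j)" by (rule member_le_sum) auto
    finally show ?thesis using True by simp
  next
    case False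
    then have "r j = 0" for j using r[of j] by simp
    then show ?thesis using False by simp
  qed
  have "0 < profile_times p q i \<longleftrightarrow> i < (if m = 0 \<or> n = 0 then 0 else max m n)" for i
    unfolding profile_times_pos_iff sum_pos[of p m, OF m] sum_pos[of q n, OF n] m n by auto
  then show ?thesis unfolding is_profile_iff by blast
qed

instantiation profile :: comm_semiring_1
begin

lift_definition zero_profile :: profile is "\<lambda>_. 0"
  by (auto simp: is_profile_iff)

lift_definition one_profile :: profile is "\<lambda>i. if i = 0 then 1 else 0"
  unfolding is_profile_iff by (rule exI[of _ 1]) auto

lift_definition plus_profile :: "profile \<Rightarrow> profile \<Rightarrow> profile" is "\<lambda>p q i. p i + q i"
proof -
  fix p q :: "nat \<Rightarrow> nat"
  assume "is_profile p" "is_profile q"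
  then obtain m n where "\<And>i. 0 < p i \<longleftrightarrow> i < m" "\<And>i. 0 < q i \<longleftrightarrow> i < n"
    by (auto simp: is_profile_iff)
  then have "0 < p i + q i \<longleftrightarrow> i < max m n" for i
    by (metis add_gr_0 less_max_iff_disj)
  then show "is_profile (\<lambda>i. p i + q i)"
    unfolding is_profile_iff by blast
qed

lift_definition times_profile :: "profile \<Rightarrow> profile \<Rightarrow> profile" is profile_times
  by (rule is_profile_times)

instance
proof
  fix a b c :: profile
  show "a + b + c = a + (b + c)" by transfer (simp add: add.assoc)
  show "a + b = b + a" by transfer (simp add: add.commute)
  show "0 + a = a" by transfer simp
  show "a * b * c = a * (b * c)"
    by transfer (rule partial_sums_eqI, simp add: sum_profile_times mult.assoc)
  show "a * b = b * a"
    by transfer (rule partial_sums_eqI, simp add: sum_profile_times mult.commute)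
  show "1 * a = a"
    by transfer (rule partial_sums_eqI, simp add: sum_profile_times)
  show "(a + b) * c = a * c + b * c"
    by transfer
      (rule partial_sums_eqI, simp add: sum_profile_times sum.distrib distrib_right)
  show "0 * a = 0"
    by transfer (rule partial_sums_eqI, simp add: sum_profile_times)
  show "a * 0 = 0"
    by transfer (rule partial_sums_eqI, simp add: sum_profile_times)
  show "(0::profile) \<noteq> 1" by transfer (metis zero_neq_one)
qed

end

text \<open>
  A polynomial maps exponent vectors to coefficients, with finite support; the variable with
  index \<open>i\<close> is \<open>X\<^sub>i\<^sub>+\<^sub>1\<close>, so that \<open>polys_in m\<close> is the set of polynomials in
  \<open>X\<^sub>1, \<dots>, X\<^sub>m\<close>.
\<close>

type_synonym profile_poly = "(nat \<Rightarrow>\<^sub>0 nat) \<Rightarrow>\<^sub>0 profile"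

definition polys_in :: "nat \<Rightarrow> profile_poly set" where
  "polys_in m = {p. \<forall>e \<in> Poly_Mapping.keys p. Poly_Mapping.keys e \<subseteq> {..<m}}"

definition poly_value :: "profile_poly \<Rightarrow> profile list \<Rightarrow> profile" where
  "poly_value p xs = (\<Sum>e \<in> Poly_Mapping.keys p.
    Poly_Mapping.lookup p e * (\<Prod>i < length xs. xs ! i ^ Poly_Mapping.lookup e i))"

definition has_solution :: "nat \<Rightarrow> profile_poly \<Rightarrow> profile_poly \<Rightarrow> bool" where
  "has_solution m p q \<longleftrightarrow> (\<exists>xs. length xs = m \<and> poly_value p xs = poly_value q xs)"

datatype symbol = Digit bool | Comma | Bar | Semicolon | Stop

fun binary :: "nat \<Rightarrow> symbol list" where
  "binary n = (if n < 2 then [] else binary (n div 2)) @ [Digit (odd n)]"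

declare binary.simps [simp del]

definition encode_nats :: "nat list \<Rightarrow> symbol list" where
  "encode_nats ns = concat (map (\<lambda>n. binary n @ [Comma]) ns)"

definition nonzero_terms :: "profile \<Rightarrow> nat list" where
  "nonzero_terms p = map (profile_nth p) [0..<(LEAST n. profile_nth p n = 0)]"

definition encode_monomial :: "nat \<Rightarrow> (nat \<Rightarrow>\<^sub>0 nat) \<times> profile \<Rightarrow> symbol list" where
  "encode_monomial m = (\<lambda>(e, c).
    encode_nats (nonzero_terms c) @ [Bar] @
    encode_nats (map (Poly_Mapping.lookup e) [0..<m]) @ [Semicolon])"

text \<open>
  \<^const>\<open>Poly_Mapping.items\<close> lists the monomials with nonzero coefficient once each, in increasing
  lexicographic order of their exponent vectors.
\<close>

definition encode_poly :: "nat \<Rightarrow> profile_poly \<Rightarrow> symbol list" where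
  "encode_poly m p = concat (map (encode_monomial m) (Poly_Mapping.items p)) @ [Stop]"

type_synonym equation = "nat \<times> profile_poly \<times> profile_poly"

definition encode_equation :: "equation \<Rightarrow> symbol list" where
  "encode_equation = (\<lambda>(m, p, q). encode_nats [m] @ encode_poly m p @ encode_poly m q)"

definition equations :: "equation set" where
  "equations = {(m, p, q). p \<in> polys_in m \<and> q \<in> polys_in m}"

lemma prefix_unique:
  assumes "xs @ s # us = ys @ s # vs" "s \<notin> set xs" "s \<notin> set ys"
  shows "xs = ys \<and> us = vs"
  using assms
proof (induction xs arbitrary: ys)
  case Nil
  then show ?case by (cases ys) auto
next
  case (Cons x xs)
  then show ?case by (cases ys) auto
qed

lemma binary_symbols: "set (binary n) \<subseteq> range Digit"
proof (induction n rule: binary.induct)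
  case (1 n)
  then show ?case by (subst binary.simps) auto
qed

lemma binary_ne_Nil: "binary n \<noteq> []"
  by (subst binary.simps) simp

lemma inj_binary: "binary m = binary n \<Longrightarrow> m = n"
proof (induction m arbitrary: n rule: binary.induct)
  case (1 m)
  have eq: "(if m < 2 then [] else binary (m div 2)) = (if n < 2 then [] else binary (n div 2))"
    and par: "odd m = odd n"
    using 1(2) by (simp_all only: binary.simps[of m] binary.simps[of n] append1_eq_conv symbol.inject)
  show ?case
  proof (cases "m < 2")
    case True
    then have "n < 2" using eq binary_ne_Nil[of "n div 2"] by (metis (full_types))
    then show ?thesis using True par by (auto simp: less_2_cases_iff)
  next
    case False
    then have n: "\<not> n < 2" using eq binary_ne_Nil[of "m div 2"] by (metis (full_types))
    then have "m div 2 = n div 2" using 1(1)[OF False] eq False by simp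
    then show ?thesis using par by (metis odd_iff_mod_2_eq_one not_mod_2_eq_1_eq_0 div_mult_mod_eq)
  qed
qed

lemma encode_nats_symbols: "set (encode_nats ns) \<subseteq> insert Comma (range Digit)"
  unfolding encode_nats_def using binary_symbols by (induction ns) (auto simp: subset_iff)

lemma inj_encode_nats: "encode_nats ms = encode_nats ns \<Longrightarrow> ms = ns"
proof (induction ms arbitrary: ns)
  case Nil
  then show ?case by (cases ns) (auto simp: encode_nats_def)
next
  case (Cons m ms)
  then obtain n ns' where ns: "ns = n # ns'"
    by (cases ns) (auto simp: encode_nats_def)
  have "binary m @ Comma # encode_nats ms = binary n @ Comma # encode_nats ns'"
    using Cons.prems by (simp add: ns encode_nats_def)
  from prefix_unique[OF this] have "binary m = binary n" "encode_nats ms = encode_nats ns'"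
    using binary_symbols by fastforce+
  then show ?case using Cons.IH inj_binary ns by blast
qed

lemma inj_nonzero_terms: "nonzero_terms p = nonzero_terms q \<Longrightarrow> p = q"
proof -
  have nth: "profile_nth p i = (if i < length (nonzero_terms p) then nonzero_terms p ! i else 0)"
    for p i
  proof -
    have "is_profile (profile_nth p)" using profile_nth by simp
    then obtain n where n: "\<And>i. 0 < profile_nth p i \<longleftrightarrow> i < n" by (auto simp: is_profile_iff)
    have "(LEAST n. profile_nth p n = 0) = n"
      by (rule Least_equality) (use n in \<open>metis less_irrefl neq0_conv not_le\<close>)+
    then show ?thesis using n[of i] by (auto simp: nonzero_terms_def)
  qed
  assume "nonzero_terms p = nonzero_terms q"
  then have "profile_nth p = profile_nth q" by (simp add: fun_eq_iff nth)
  then show "p = q" by (simp add: profile_nth_inject)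
qed

lemma encode_monomial_symbols:
  "\<exists>w. encode_monomial m t = w @ [Semicolon] \<and> Semicolon \<notin> set w \<and> Stop \<notin> set w"
  using encode_nats_symbols
  by (cases t) (fastforce simp: encode_monomial_def)

lemma inj_encode_monomial:
  assumes "encode_monomial m (e, c) = encode_monomial m (e', c')"
    and "Poly_Mapping.keys e \<subseteq> {..<m}" "Poly_Mapping.keys e' \<subseteq> {..<m}"
  shows "(e, c) = (e', c')"
proof -
  have "encode_nats (nonzero_terms c) @ Bar #
        (encode_nats (map (Poly_Mapping.lookup e) [0..<m]) @ [Semicolon]) =
      encode_nats (nonzero_terms c') @ Bar #
        (encode_nats (map (Poly_Mapping.lookup e') [0..<m]) @ [Semicolon])"
    using assms(1) by (simp add: encode_monomial_def)
  from prefix_unique[OF this]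
  have c: "encode_nats (nonzero_terms c) = encode_nats (nonzero_terms c')"
    and e: "encode_nats (map (Poly_Mapping.lookup e) [0..<m]) =
      encode_nats (map (Poly_Mapping.lookup e') [0..<m])"
    using encode_nats_symbols by fastforce+
  have "c = c'" using c inj_encode_nats inj_nonzero_terms by blast
  have "map (Poly_Mapping.lookup e) [0..<m] = map (Poly_Mapping.lookup e') [0..<m]"
    using e by (rule inj_encode_nats)
  then have "Poly_Mapping.lookup e i = Poly_Mapping.lookup e' i" if "i < m" for i using that by simp
  moreover have "Poly_Mapping.lookup e i = Poly_Mapping.lookup e' i" if "\<not> i < m" for i
    using that assms(2,3) by (metis in_keys_iff lessThan_iff subsetD)
  ultimately have "e = e'" by (metis poly_mapping_eqI)
  then show ?thesis using \<open>c = c'\<close> by simp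
qed

lemma inj_encode_monomials:
  assumes "concat (map (encode_monomial m) ts) = concat (map (encode_monomial m) us)"
    and "\<forall>t \<in> set ts. Poly_Mapping.keys (fst t) \<subseteq> {..<m}"
    and "\<forall>u \<in> set us. Poly_Mapping.keys (fst u) \<subseteq> {..<m}"
  shows "ts = us"
  using assms
proof (induction ts arbitrary: us)
  case Nil
  then show ?case by (cases us) (auto simp: encode_monomial_def split: prod.splits)
next
  case (Cons t ts)
  then obtain u us' where us: "us = u # us'"
    by (cases us) (auto simp: encode_monomial_def split: prod.splits)
  obtain v where v: "encode_monomial m t = v @ [Semicolon]" "Semicolon \<notin> set v"
    using encode_monomial_symbols by blast
  obtain w where w: "encode_monomial m u = w @ [Semicolon]" "Semicolon \<notin> set w"
    using encode_monomial_symbols by blast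
  have "v @ Semicolon # concat (map (encode_monomial m) ts) =
      w @ Semicolon # concat (map (encode_monomial m) us')"
    using Cons.prems(1) by (simp add: us v(1) w(1))
  from prefix_unique[OF this v(2) w(2)]
  have "v = w" and rest: "concat (map (encode_monomial m) ts) = concat (map (encode_monomial m) us')"
    by auto
  then have "encode_monomial m t = encode_monomial m u" using v w by simp
  then have "t = u"
    using inj_encode_monomial[of m "fst t" "snd t" "fst u" "snd u"] Cons.prems us by simp
  moreover have "ts = us'" using Cons.IH rest Cons.prems us by simp
  ultimately show ?case using us by simp
qed

lemma set_items:
  "set (Poly_Mapping.items p) = (\<lambda>e. (e, Poly_Mapping.lookup p e)) ` Poly_Mapping.keys p"
  by (auto simp: Poly_Mapping.items_def)

lemma inj_encode_poly:
  assumes "encode_poly m p @ us = encode_poly m q @ vs" "p \<in> polys_in m" "q \<in> polys_in m"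
  shows "p = q \<and> us = vs"
proof -
  have "Stop \<notin> set (concat (map (encode_monomial m) ts))" for ts
  proof -
    have "Stop \<notin> set (encode_monomial m t)" for t
      using encode_monomial_symbols[of m t] by auto
    then show ?thesis by auto
  qed
  then have *: "concat (map (encode_monomial m) (Poly_Mapping.items p)) =
      concat (map (encode_monomial m) (Poly_Mapping.items q))" and "us = vs"
    using prefix_unique[of "concat (map (encode_monomial m) (Poly_Mapping.items p))" Stop us
        "concat (map (encode_monomial m) (Poly_Mapping.items q))" vs] assms(1)
    by (simp_all add: encode_poly_def)
  have "Poly_Mapping.items p = Poly_Mapping.items q"
    using * assms(2,3) by (intro inj_encode_monomials) (auto simp: set_items polys_in_def)
  then have s: "(\<lambda>e. (e, Poly_Mapping.lookup p e)) ` Poly_Mapping.keys p =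
      (\<lambda>e. (e, Poly_Mapping.lookup q e)) ` Poly_Mapping.keys q"
    by (simp flip: set_items)
  have "Poly_Mapping.lookup p e = Poly_Mapping.lookup q e" for e
  proof -
    have "e \<in> Poly_Mapping.keys p \<Longrightarrow> Poly_Mapping.lookup p e = Poly_Mapping.lookup q e"
      "e \<in> Poly_Mapping.keys q \<Longrightarrow> Poly_Mapping.lookup p e = Poly_Mapping.lookup q e"
      using s by (auto simp: image_def set_eq_iff)
    then show ?thesis by (metis in_keys_iff)
  qed
  then show ?thesis using \<open>us = vs\<close> by (simp add: poly_mapping_eqI)
qed

lemma inj_on_encode_equation: "inj_on encode_equation equations"
proof (rule inj_onI, unfold split_paired_all)
  fix m p q m' p' q'
  assume eqs: "(m, p, q) \<in> equations" "(m', p', q') \<in> equations"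
    and eq: "encode_equation (m, p, q) = encode_equation (m', p', q')"
  have "binary m @ Comma # (encode_poly m p @ encode_poly m q) =
      binary m' @ Comma # (encode_poly m' p' @ encode_poly m' q')"
    using eq by (simp add: encode_equation_def encode_nats_def)
  from prefix_unique[OF this] have "binary m = binary m'"
    and *: "encode_poly m p @ encode_poly m q = encode_poly m' p' @ encode_poly m' q'"
    using binary_symbols by fastforce+
  then have m: "m = m'" by (simp add: inj_binary)
  have p: "p = p' \<and> encode_poly m q = encode_poly m q'"
    using inj_encode_poly[OF *[folded m]] eqs m by (simp add: equations_def)
  then have "q = q'"
    using inj_encode_poly[of m q "[]" q' "[]"] eqs m by (simp add: equations_def)
  then show "(m, p, q) = (m', p', q')" using m p by simp
qed

text \<open>The model of computation is that of the \<open>\<mu>\<close>-recursive functions.\<close>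

datatype recf =
    ZeroF
  | SuccF
  | Proj nat
  | Comp recf "recf list"
  | PrimRec recf recf
  | Mu recf

text \<open>
  \<open>computes f xs y\<close>: the partial function \<open>f\<close> is defined on the arguments \<open>xs\<close>, with value \<open>y\<close>.
\<close>

inductive computes :: "recf \<Rightarrow> nat list \<Rightarrow> nat \<Rightarrow> bool" where
  "computes ZeroF xs 0"
| "computes SuccF [x] (Suc x)"
| "i < length xs \<Longrightarrow> computes (Proj i) xs (xs ! i)"
| "list_all2 (\<lambda>g y. computes g xs y) gs ys \<Longrightarrow> computes f ys z \<Longrightarrow> computes (Comp f gs) xs z"
| "computes f xs y \<Longrightarrow> computes (PrimRec f g) (0 # xs) y"
| "computes (PrimRec f g) (n # xs) y \<Longrightarrow> computes g (n # y # xs) z \<Longrightarrow>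
    computes (PrimRec f g) (Suc n # xs) z"
| "computes f (n # xs) 0 \<Longrightarrow> (\<forall>k < n. \<exists>y. computes f (k # xs) (Suc y)) \<Longrightarrow>
    computes (Mu f) xs n"

inductive_cases computes_ZeroE: "computes ZeroF xs z"
inductive_cases computes_SuccE: "computes SuccF xs z"
inductive_cases computes_ProjE: "computes (Proj i) xs z"
inductive_cases computes_CompE: "computes (Comp f gs) xs z"
inductive_cases computes_PrimRec0E: "computes (PrimRec f g) (0 # xs) z"
inductive_cases computes_PrimRecSucE: "computes (PrimRec f g) (Suc n # xs) z"
inductive_cases computes_MuE: "computes (Mu f) xs z"

lemma computes_deterministic: "computes f xs y \<Longrightarrow> computes f xs z \<Longrightarrow> y = z"
proof (induction arbitrary: z rule: computes.induct)
  case (1 xs)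
  then show ?case by (rule computes_ZeroE) simp
next
  case (2 x)
  then show ?case by (rule computes_SuccE) simp
next
  case (3 i xs)
  from 3(2) show ?case by (rule computes_ProjE) simp
next
  case (4 xs gs ys f v)
  from 4(4) obtain ys' where ys': "list_all2 (\<lambda>g y. computes g xs y) gs ys'" "computes f ys' z"
    by (rule computes_CompE)
  have "ys = ys'"
    using 4(1) ys'(1) by (auto simp: list_all2_conv_all_nth intro!: nth_equalityI)
  then have "computes f ys z" using ys'(2) by simp
  then show ?case by (blast intro: 4)
next
  case (5 f xs y g)
  from 5(3) have "computes f xs z" by (rule computes_PrimRec0E)
  then show ?case by (blast intro: 5)
next
  case (6 f g n xs y v)
  from 6(5) obtain y' where y': "computes (PrimRec f g) (n # xs) y'" "computes g (n # y' # xs) z"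
    by (rule computes_PrimRecSucE)
  have "y = y'" using y'(1) by (blast intro: 6)
  then have "computes g (n # y # xs) z" using y'(2) by simp
  then show ?case by (blast intro: 6)
next
  case (7 f n xs)
  from 7(4) have z: "computes f (z # xs) 0" "\<forall>k < z. \<exists>y. computes f (k # xs) (Suc y)"
    by (auto elim: computes_MuE)
  show ?case
  proof (cases n z rule: linorder_cases)
    case less
    then obtain y where "computes f (n # xs) (Suc y)" using z(2) by blast
    then have "0 = Suc y" by (blast intro: 7)
    then show ?thesis by simp
  next
    case greater
    then obtain y where y: "\<And>w. computes f (z # xs) w \<Longrightarrow> Suc y = w" using 7(3) by blast
    then have "Suc y = 0" using z(1) by blast
    then show ?thesis by simp
  qed
qed

fun symbol_code :: "symbol \<Rightarrow> nat" where
  "symbol_code (Digit b) = (if b then 1 else 0)"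
| "symbol_code Comma = 2"
| "symbol_code Bar = 3"
| "symbol_code Semicolon = 4"
| "symbol_code Stop = 5"

definition word_code :: "symbol list \<Rightarrow> nat" where
  "word_code w = list_encode (map symbol_code w)"

lemma inj_word_code: "inj word_code"
proof -
  have "inj symbol_code"
  proof (rule injI)
    fix s t assume "symbol_code s = symbol_code t"
    then show "s = t" by (cases s; cases t) (auto split: if_splits)
  qed
  then show ?thesis by (auto intro!: injI simp: word_code_def list_encode_eq inj_map_eq_map)
qed

text \<open>
  Decidability of the property \<open>Q\<close> of the instances in \<open>I\<close>, given to the algorithm as words through
  the encoding \<open>enc\<close>.  Nothing is required of the algorithm on words that encode no instance.
\<close>

definition decidable_problem :: "('a \<Rightarrow> symbol list) \<Rightarrow> 'a set \<Rightarrow> ('a \<Rightarrow> bool) \<Rightarrow> bool" where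
  "decidable_problem enc I Q \<longleftrightarrow>
    (\<exists>f. \<forall>x \<in> I. computes f [word_code (enc x)] (if Q x then 1 else 0))"

end

theory Submission
  imports Defs "HOL-Number_Theory.Cong"
begin

text \<open>
  Reading a profile at index \<open>0\<close> and embedding \<open>n\<close> as \<open>(n, 0, 0, \<dots>)\<close> are semiring homomorphisms, so an
  equation whose coefficients are embedded natural numbers is solvable in profiles iff it is solvable
  in natural numbers, and Hilbert's tenth problem remains.

  Exponentiation is Diophantine through the Pell equation \<open>x\<^sup>2 - (a\<^sup>2 - 1) y\<^sup>2 = 1\<close>; binomial
  coefficients are digits of \<open>(u + 1) ^ n\<close> in base \<open>u\<close>, and \<open>n!\<close> is the quotient of \<open>r ^ n\<close> by
  \<open>r choose n\<close> for large \<open>r\<close>.  A bounded universal quantifier is eliminated by the Chinese remainder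
  theorem.  With sequences coded as digit expansions, the graph of every \<open>\<mu>\<close>-recursive function is
  Diophantine.

  No universal function is needed for the diagonal argument.  Given a decision procedure \<open>f\<close>, the set
  of numbers coding an equation up to its constant coefficient, and for which \<open>f\<close> denies a solution
  once that very number is inserted as the constant coefficient, is Diophantine.  Hence it is given by some
  equation, and \<open>f\<close> errs on this equation with its own code inserted.
\<close>

section \<open>Solutions of the Pell equation\<close>

text \<open>The powers of \<open>a + sqrt (a^2 - 1)\<close>: its \<open>n\<close>-th power is
  \<open>pell_x a n + pell_y a n * sqrt (a^2 - 1)\<close>.\<close>

fun pell_x :: "int \<Rightarrow> nat \<Rightarrow> int" and pell_y :: "int \<Rightarrow> nat \<Rightarrow> int" where
  "pell_x a 0 = 1"
| "pell_y a 0 = 0"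
| "pell_x a (Suc n) = a * pell_x a n + (a\<^sup>2 - 1) * pell_y a n"
| "pell_y a (Suc n) = pell_x a n + a * pell_y a n"

text \<open>Powers multiply by adding exponents; the two equations are the rational and irrational
  parts of that product.\<close>

lemma pell_add:
  "pell_x a (m + n) = pell_x a m * pell_x a n + (a\<^sup>2 - 1) * pell_y a m * pell_y a n"
  "pell_y a (m + n) = pell_x a m * pell_y a n + pell_y a m * pell_x a n"
proof (induction m)
  case (Suc m)
  {
    case 1
    show ?case by (simp add: Suc) algebra
  next
    case 2
    show ?case by (simp add: Suc) algebra
  }
qed simp_all

text \<open>The norm is multiplicative, and \<open>a + sqrt (a^2 - 1)\<close> has norm 1.\<close>

lemma pell_eq: "(pell_x a n)\<^sup>2 = (a\<^sup>2 - 1) * (pell_y a n)\<^sup>2 + 1"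
proof (induction n)
  case (Suc n)
  have "(pell_x a (Suc n))\<^sup>2 - (a\<^sup>2 - 1) * (pell_y a (Suc n))\<^sup>2 =
      (pell_x a n)\<^sup>2 - (a\<^sup>2 - 1) * (pell_y a n)\<^sup>2"
    by (simp add: algebra_simps power2_eq_square)
  then show ?case using Suc by linarith
qed simp

lemma coprime_pell: "coprime (pell_x a n) (pell_y a n)"
proof (rule coprimeI)
  fix d assume "d dvd pell_x a n" "d dvd pell_y a n"
  then have "d dvd (pell_x a n)\<^sup>2 - (a\<^sup>2 - 1) * (pell_y a n)\<^sup>2"
    by (simp add: power2_eq_square)
  then show "is_unit d" by (simp add: pell_eq)
qed

lemma pell_nonneg:
  assumes "1 \<le> a"
  shows "1 \<le> pell_x a n \<and> 0 \<le> pell_y a n"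
proof (induction n)
  case (Suc n)
  have "0 \<le> (a\<^sup>2 - 1) * pell_y a n" using assms Suc by simp
  moreover have "1 * 1 \<le> a * pell_x a n" using assms Suc by (intro mult_mono) auto
  moreover have "0 \<le> a * pell_y a n" using assms Suc by simp
  ultimately show ?case using Suc by simp
qed simp

lemma pell_x_Suc_ge:
  assumes "1 \<le> a"
  shows "a * pell_x a n \<le> pell_x a (Suc n)"
  using assms pell_nonneg[of a n] by simp

lemma pell_x_strict_mono:
  assumes "2 \<le> a" "m < n"
  shows "pell_x a m < pell_x a n"
proof -
  have "pell_x a n < pell_x a (Suc n)" for n
  proof -
    have "1 * pell_x a n < a * pell_x a n"
      using assms pell_nonneg[of a n] by (intro mult_strict_right_mono) auto
    then show ?thesis using pell_x_Suc_ge[of a n] assms by simp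
  qed
  then show ?thesis using assms(2) by (rule lift_Suc_mono_less)
qed

lemma pell_y_strict_mono:
  assumes "2 \<le> a" "m < n"
  shows "pell_y a m < pell_y a n"
proof -
  have "pell_y a n < pell_y a (Suc n)" for n
  proof -
    have "1 * pell_y a n \<le> a * pell_y a n"
      using assms pell_nonneg[of a n] by (intro mult_right_mono) auto
    then show ?thesis using pell_nonneg[of a n] assms by simp
  qed
  then show ?thesis using assms(2) by (rule lift_Suc_mono_less)
qed

lemma pell_y_ge: "2 \<le> a \<Longrightarrow> int n \<le> pell_y a n"
proof (induction n)
  case (Suc n)
  then show ?case using pell_y_strict_mono[of a n "Suc n"] by simp
qed simp

lemma pell_x_ge_power: "1 \<le> a \<Longrightarrow> a ^ n \<le> pell_x a n"
proof (induction n)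
  case (Suc n)
  then have "a * a ^ n \<le> a * pell_x a n" by (intro mult_left_mono) auto
  also have "\<dots> \<le> pell_x a (Suc n)" using Suc.prems by (rule pell_x_Suc_ge)
  finally show ?case by simp
qed simp

text \<open>Fermat descent: dividing a solution with \<open>y > 0\<close> by the fundamental one
  gives a solution with smaller \<open>y\<close>, and the descent ends at
  \<open>(1, 0)\<close>.\<close>

lemma pell_solutions:
  fixes x y :: int
  assumes "2 \<le> a" "0 \<le> x" "0 \<le> y" "x\<^sup>2 = (a\<^sup>2 - 1) * y\<^sup>2 + 1"
  shows "\<exists>n. x = pell_x a n \<and> y = pell_y a n"
  using assms(2-)
proof (induction "nat y" arbitrary: x y rule: less_induct)
  case less
  show ?case
  proof (cases "y = 0")
    case True
    then have "x = 1" using less.prems by (simp add: power2_eq_1_iff)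
    then show ?thesis using True by (intro exI[of _ 0]) simp
  next
    case False
    \<comment> \<open>These are the coordinates of
      \<open>(x + y sqrt (a^2 - 1)) * (a - sqrt (a^2 - 1))\<close>.\<close>
    define x' where "x' = a * x - (a\<^sup>2 - 1) * y"
    define y' where "y' = a * y - x"
    have y: "1 \<le> y" using False less.prems by simp
    have "0 < y\<^sup>2" using y by simp
    moreover have "x\<^sup>2 = (a * y)\<^sup>2 + 1 - y\<^sup>2"
      using less.prems(3) by (simp add: algebra_simps power_mult_distrib)
    ultimately have "x\<^sup>2 < (a * y)\<^sup>2 + 1" by linarith
    then have "x\<^sup>2 \<le> (a * y)\<^sup>2" by simp
    then have "x \<le> a * y" by (rule power2_le_imp_le) (use y assms(1) in simp)
    then have y': "0 \<le> y'" by (simp add: y'_def)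
    have "((a - 1) * y)\<^sup>2 < x\<^sup>2"
    proof -
      have "(a - 1)\<^sup>2 \<le> a\<^sup>2 - 1" using assms(1) by (simp add: algebra_simps power2_eq_square)
      then have "(a - 1)\<^sup>2 * y\<^sup>2 \<le> (a\<^sup>2 - 1) * y\<^sup>2" by (rule mult_right_mono) simp
      then show ?thesis using less.prems(3) by (simp add: power_mult_distrib)
    qed
    then have "(a - 1) * y < x" using less.prems(1) by (rule power2_less_imp_less)
    then have less': "y' < y" unfolding y'_def by (simp add: algebra_simps)
    have eq': "x'\<^sup>2 = (a\<^sup>2 - 1) * y'\<^sup>2 + 1"
    proof -
      have "x'\<^sup>2 - (a\<^sup>2 - 1) * y'\<^sup>2 = x\<^sup>2 - (a\<^sup>2 - 1) * y\<^sup>2"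
        unfolding x'_def y'_def by (simp add: algebra_simps power2_eq_square)
      then show ?thesis using less.prems(3) by linarith
    qed
    have x': "0 \<le> x'"
    proof -
      have "((a\<^sup>2 - 1) * y)\<^sup>2 \<le> (a * x)\<^sup>2"
      proof -
        have "(a * x)\<^sup>2 - ((a\<^sup>2 - 1) * y)\<^sup>2 = a\<^sup>2 * x\<^sup>2 - (a\<^sup>2 - 1) * ((a\<^sup>2 - 1) * y\<^sup>2)"
          by (simp add: algebra_simps power2_eq_square)
        also have "(a\<^sup>2 - 1) * y\<^sup>2 = x\<^sup>2 - 1" using less.prems(3) by simp
        also have "a\<^sup>2 * x\<^sup>2 - (a\<^sup>2 - 1) * (x\<^sup>2 - 1) = x\<^sup>2 + (a\<^sup>2 - 1)"
          by (simp add: algebra_simps)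
        finally show ?thesis using assms(1) by (smt (verit) one_le_power zero_le_power2)
      qed
      then have "(a\<^sup>2 - 1) * y \<le> a * x"
        by (rule power2_le_imp_le) (use assms(1) less.prems(1) in simp)
      then show ?thesis by (simp add: x'_def)
    qed
    obtain n where n: "pell_x a n = x'" "pell_y a n = y'"
      using less.hyps[of y' x'] x' y' eq' less' y by auto
    then have "x = pell_x a (Suc n) \<and> y = pell_y a (Suc n)"
      by (simp add: n x'_def y'_def algebra_simps power2_eq_square)
    then show ?thesis by blast
  qed
qed

section \<open>Congruences and divisibility between terms of the Pell sequences\<close>

lemma pell_diff:
  assumes "n \<le> m"
  shows "pell_x a (m - n) = pell_x a m * pell_x a n - (a\<^sup>2 - 1) * pell_y a m * pell_y a n"
proof -
  obtain k where m: "m = k + n" using assms by (metis add.commute le_Suc_ex)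
  have "pell_x a m * pell_x a n - (a\<^sup>2 - 1) * pell_y a m * pell_y a n =
      pell_x a k * ((pell_x a n)\<^sup>2 - (a\<^sup>2 - 1) * (pell_y a n)\<^sup>2)"
    unfolding m pell_add by (simp add: algebra_simps power2_eq_square)
  then show ?thesis by (simp add: m pell_eq)
qed

lemma pell_double:
  "pell_x a (2 * n) = 2 * (pell_x a n)\<^sup>2 - 1"
  "pell_y a (2 * n) = 2 * pell_x a n * pell_y a n"
  using pell_add[of a n n] pell_eq[of a n] unfolding mult_2[of n] by algebra+

text \<open>Modulo \<open>pell_x a n\<close> the doubling formulas give -1 and 0 for the terms of
  index \<open>2 * n\<close>, so a shift by \<open>2 * n\<close> or a reflection at \<open>n\<close>
  only changes the sign of \<open>pell_x\<close>.\<close>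

lemma pell_x_reflect:
  shows "pell_x a n dvd pell_x a (2 * n + r) + pell_x a r"
    and "r \<le> 2 * n \<Longrightarrow> pell_x a n dvd pell_x a (2 * n - r) + pell_x a r"
proof -
  have "pell_x a (2 * n + r) + pell_x a r =
      pell_x a n * (2 * pell_x a n * pell_x a r + (a\<^sup>2 - 1) * 2 * pell_y a n * pell_y a r)"
    unfolding pell_add pell_double by (simp add: algebra_simps power2_eq_square)
  then show "pell_x a n dvd pell_x a (2 * n + r) + pell_x a r" by simp
  assume "r \<le> 2 * n"
  then have "pell_x a (2 * n - r) + pell_x a r =
      pell_x a n * (2 * pell_x a n * pell_x a r - (a\<^sup>2 - 1) * 2 * pell_y a n * pell_y a r)"
    unfolding pell_diff[OF \<open>r \<le> 2 * n\<close>] pell_double by (simp add: algebra_simps power2_eq_square)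
  then show "pell_x a n dvd pell_x a (2 * n - r) + pell_x a r" by simp
qed

text \<open>Repeated reflection folds every index into \<open>0..n\<close>, at the cost of signs and
  of multiples of \<open>2 * n\<close>.\<close>

lemma pell_x_reduce:
  assumes "0 < n"
  shows "\<exists>i \<le> n. ([int j = int i] (mod (2 * int n)) \<or> [int j = - int i] (mod (2 * int n))) \<and>
    (pell_x a n dvd pell_x a j - pell_x a i \<or> pell_x a n dvd pell_x a j + pell_x a i)"
proof (induction j rule: less_induct)
  case (less j)
  consider "j \<le> n" | "n < j" "j \<le> 2 * n" | "2 * n < j" by linarith
  then show ?case
  proof cases
    case 1
    then show ?thesis by (intro exI[of _ j]) simp
  next
    case 2
    define i where "i = 2 * n - j"
    have i: "j = 2 * n - i" "i \<le> 2 * n" "i \<le> n" using 2 by (simp_all add: i_def)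
    have "[int j = - int i] (mod (2 * int n))"
      using i by (simp add: cong_iff_dvd_diff of_nat_diff)
    then show ?thesis using i pell_x_reflect(2)[of i n a] by blast
  next
    case 3
    define k where "k = j - 2 * n"
    have k: "j = 2 * n + k" "k < j" using 3 assms by (simp_all add: k_def)
    from less[OF k(2)] obtain i where i: "i \<le> n"
      "[int k = int i] (mod (2 * int n)) \<or> [int k = - int i] (mod (2 * int n))"
      "pell_x a n dvd pell_x a k - pell_x a i \<or> pell_x a n dvd pell_x a k + pell_x a i" by blast
    have "[int j = int k] (mod (2 * int n))" using k by (simp add: cong_iff_dvd_diff)
    moreover have d: "pell_x a n dvd pell_x a j + pell_x a k"
      using pell_x_reflect(1)[of a n k] k by simp
    have "pell_x a n dvd pell_x a j - pell_x a i \<or> pell_x a n dvd pell_x a j + pell_x a i"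
      using i(3)
    proof
      assume "pell_x a n dvd pell_x a k - pell_x a i"
      from dvd_diff[OF d this] show ?thesis by simp
    next
      assume "pell_x a n dvd pell_x a k + pell_x a i"
      from dvd_diff[OF d this] show ?thesis by simp
    qed
    ultimately show ?thesis using i(1,2) cong_trans by blast
  qed
qed

text \<open>The sequence grows so fast that sums and differences of two distinct terms up to index
  \<open>n\<close> are too small to be multiples of \<open>pell_x a n\<close>. A sum that involves
  the term \<open>n\<close> itself reduces to the smaller term.\<close>

lemma pell_x_cong_eq:
  assumes "2 \<le> a" "i \<le> n" "j \<le> n"
    and "pell_x a n dvd pell_x a i - pell_x a j \<or> pell_x a n dvd pell_x a i + pell_x a j"
  shows "i = j"
proof -
  have False if ij: "i < j" "j \<le> n"
    and dvd: "pell_x a n dvd pell_x a j - pell_x a i \<or> pell_x a n dvd pell_x a j + pell_x a i" for i j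
  proof -
    have lt: "pell_x a i < pell_x a j" using pell_x_strict_mono assms(1) ij by blast
    have le: "pell_x a j \<le> pell_x a n"
      using pell_x_strict_mono[of a j n] assms(1) ij by (cases "j = n") auto
    have pos: "1 \<le> pell_x a i" using pell_nonneg assms(1) by simp
    from dvd show False
    proof
      assume "pell_x a n dvd pell_x a j - pell_x a i"
      then show False using lt le pos zdvd_imp_le[of "pell_x a n" "pell_x a j - pell_x a i"] by simp
    next
      assume dvd': "pell_x a n dvd pell_x a j + pell_x a i"
      show False
      proof (cases "j = n")
        case True
        then have "pell_x a n dvd pell_x a i" using dvd' by (metis dvd_add_triv_left_iff)
        then show False using True lt pos zdvd_imp_le[of "pell_x a n" "pell_x a i"] by simp
      next
        case False
        then obtain n' where n: "n = Suc n'" "j \<le> n'" using ij by (cases n) auto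
        have "pell_x a j \<le> pell_x a n'"
          using pell_x_strict_mono[of a j n'] assms(1) n by (cases "j = n'") auto
        then have "pell_x a j + pell_x a i < 2 * pell_x a n'" using lt by simp
        also have "\<dots> \<le> a * pell_x a n'"
          using assms(1) pell_nonneg[of a n'] by (intro mult_right_mono) auto
        also have "\<dots> \<le> pell_x a n" using pell_x_Suc_ge[of a n'] assms(1) n by simp
        finally show False
          using lt pos dvd' zdvd_imp_le[of "pell_x a n" "pell_x a j + pell_x a i"] by simp
      qed
    qed
  qed
  note less_False = this
  show ?thesis
  proof (rule linorder_cases[of i j])
    assume "i < j"
    moreover have "pell_x a n dvd pell_x a j - pell_x a i \<or> pell_x a n dvd pell_x a j + pell_x a i"
      using assms(4) by (metis add.commute dvd_minus_iff minus_diff_eq)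
    ultimately show ?thesis using less_False assms(3) by blast
  next
    assume "j < i"
    then show ?thesis using less_False assms(2,4) by blast
  qed
qed

lemma pell_x_cong_imp:
  assumes "2 \<le> a" "i \<le> n" "0 < n" "[pell_x a j = pell_x a i] (mod pell_x a n)"
  shows "[int j = int i] (mod (2 * int n)) \<or> [int j = - int i] (mod (2 * int n))"
proof -
  obtain k where k: "k \<le> n"
    "[int j = int k] (mod (2 * int n)) \<or> [int j = - int k] (mod (2 * int n))"
    "pell_x a n dvd pell_x a j - pell_x a k \<or> pell_x a n dvd pell_x a j + pell_x a k"
    using pell_x_reduce[OF assms(3)] by blast
  have d: "pell_x a n dvd pell_x a j - pell_x a i" using assms(4) by (simp add: cong_iff_dvd_diff)
  from k(3) have "pell_x a n dvd pell_x a i - pell_x a k \<or> pell_x a n dvd pell_x a i + pell_x a k"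
  proof
    assume "pell_x a n dvd pell_x a j - pell_x a k"
    from dvd_diff[OF this d] show ?thesis by simp
  next
    assume "pell_x a n dvd pell_x a j + pell_x a k"
    from dvd_diff[OF this d] show ?thesis by (simp add: algebra_simps)
  qed
  then have "i = k" using pell_x_cong_eq assms k(1) by blast
  then show ?thesis using k by blast
qed

text \<open>In the binomial expansion of the \<open>q\<close>-th power of
  \<open>x + y sqrt (a^2 - 1)\<close>, all terms of degree at least 2 in \<open>y\<close> vanish
  modulo \<open>y^2\<close>. The second congruence carries an extra factor \<open>pell_x a i\<close>
  to avoid the exponent \<open>q - 1\<close>.\<close>

lemma pell_mult:
  "[pell_x a (i * q) = pell_x a i ^ q] (mod (pell_y a i)\<^sup>2)"
  "[pell_y a (i * q) * pell_x a i = int q * pell_x a i ^ q * pell_y a i] (mod (pell_y a i)\<^sup>2)"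
proof (induction q)
  case 0
  {
    case 1
    show ?case by simp
  next
    case 2
    show ?case by simp
  }
next
  case (Suc q)
  let ?x = "pell_x a i" and ?y = "pell_y a i" and ?X = "pell_x a (i * q)" and ?Y = "pell_y a (i * q)"
  have dvd: "?y dvd ?Y"
  proof -
    have "?y dvd ?Y * ?x"
      using Suc(2) by (metis cong_dvd_iff cong_dvd_modulus dvd_triv_left dvd_triv_right power2_eq_square)
    then show ?thesis using coprime_pell[of a i] by (metis coprime_commute coprime_dvd_mult_left_iff)
  qed
  then obtain z where z: "?Y = ?y * z" by blast
  {
    case 1
    have "[?x * ?X + (a\<^sup>2 - 1) * ?y * ?Y = ?x * ?x ^ q + 0] (mod ?y\<^sup>2)"
      using Suc(1) by (intro cong_add cong_mult cong_refl)
        (simp_all add: z cong_0_iff power2_eq_square mult.assoc)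
    then show ?case by (simp add: pell_add)
  next
    case 2
    have "[?x * (?Y * ?x) + ?X * (?y * ?x) = ?x * (int q * ?x ^ q * ?y) + ?x ^ q * (?y * ?x)]
        (mod ?y\<^sup>2)"
      by (rule cong_add[OF cong_mult[OF cong_refl Suc(2)] cong_mult[OF Suc(1) cong_refl]])
    then show ?case by (simp add: pell_add algebra_simps)
  }
qed

lemma pell_y_dvd_mult: "pell_y a i dvd pell_y a (i * q)"
proof -
  have "pell_y a i dvd pell_y a (i * q) * pell_x a i"
    using pell_mult(2)[of a i q]
    by (metis cong_dvd_iff cong_dvd_modulus dvd_triv_left dvd_triv_right power2_eq_square)
  then show ?thesis using coprime_pell[of a i] by (metis coprime_commute coprime_dvd_mult_left_iff)
qed

text \<open>By \<open>pell_mult\<close>, \<open>pell_y a (i * q)\<close> is \<open>q\<close> times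
  \<open>pell_y a i\<close> up to a factor coprime to \<open>pell_y a i\<close>. This lets the
  values of the sequence control divisibility of the indices.\<close>

lemma pell_y_sq_dvd_iff:
  assumes "0 < pell_y a i"
  shows "(pell_y a i)\<^sup>2 dvd pell_y a (i * q) \<longleftrightarrow> pell_y a i dvd int q"
proof -
  let ?x = "pell_x a i" and ?y = "pell_y a i"
  have cop: "coprime ?y (?x ^ q)" using coprime_pell[of a i] by (simp add: coprime_commute)
  have "?y\<^sup>2 dvd pell_y a (i * q) \<longleftrightarrow> ?y\<^sup>2 dvd pell_y a (i * q) * ?x"
    using coprime_pell[of a i] by (metis coprime_commute coprime_dvd_mult_left_iff coprime_power_left_iff)
  also have "\<dots> \<longleftrightarrow> ?y\<^sup>2 dvd int q * ?x ^ q * ?y"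
    using pell_mult(2)[of a i q] by (metis cong_dvd_iff cong_refl dvd_refl cong_dvd_modulus)
  also have "\<dots> \<longleftrightarrow> ?y dvd int q * ?x ^ q" using assms by (simp add: power2_eq_square)
  also have "\<dots> \<longleftrightarrow> ?y dvd int q" using cop by (simp add: coprime_dvd_mult_left_iff)
  finally show ?thesis .
qed

text \<open>Division of \<open>n\<close> by \<open>i\<close> with remainder leaves a term
  \<open>pell_y a (n mod i)\<close> divisible by \<open>pell_y a i\<close> but smaller than it,
  hence zero.\<close>

lemma pell_y_dvd_imp_dvd:
  assumes "2 \<le> a" "0 < i" "pell_y a i dvd pell_y a n"
  shows "i dvd n"
proof -
  let ?q = "n div i" and ?r = "n mod i"
  have "pell_y a n = pell_x a (i * ?q) * pell_y a ?r + pell_y a (i * ?q) * pell_x a ?r"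
    using pell_add(2)[of a "i * ?q" ?r] by simp
  then have "pell_y a i dvd pell_x a (i * ?q) * pell_y a ?r"
    using assms(3) pell_y_dvd_mult[of a i ?q] by (metis dvd_add_left_iff dvd_mult2)
  moreover have "coprime (pell_y a i) (pell_x a (i * ?q))"
    using coprime_pell[of a "i * ?q"] pell_y_dvd_mult[of a i ?q]
    by (metis coprime_commute coprime_divisors dvd_refl)
  ultimately have dvd: "pell_y a i dvd pell_y a ?r" by (simp add: coprime_dvd_mult_right_iff)
  have lt: "pell_y a ?r < pell_y a i" using assms by (intro pell_y_strict_mono) auto
  have "\<not> 0 < ?r"
  proof
    assume "0 < ?r"
    then have "0 < pell_y a ?r" using pell_y_strict_mono[of a 0 ?r] assms(1) by simp
    then show False using zdvd_imp_le[OF dvd] lt by simp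
  qed
  then show ?thesis by (simp add: mod_eq_0_iff_dvd)
qed

text \<open>For base 1 the recursion yields 1 and \<open>n\<close>, and \<open>a\<close> is 1 modulo
  \<open>a - 1\<close>. So the index can be recovered from the value.\<close>

lemma pell_y_cong_index:
  "[pell_x a n = 1] (mod (a - 1)) \<and> [pell_y a n = int n] (mod (a - 1))"
proof (induction n)
  case (Suc n)
  have a: "[a = 1] (mod (a - 1))" by (simp add: cong_iff_dvd_diff)
  have "[a\<^sup>2 - 1 = 0] (mod (a - 1))" using cong_diff[OF cong_pow[OF a, of 2] cong_refl[of 1]] by simp
  then have "[a * pell_x a n + (a\<^sup>2 - 1) * pell_y a n = 1 * 1 + 0 * int n] (mod (a - 1))"
    using a Suc by (intro cong_add cong_mult) auto
  moreover have "[pell_x a n + a * pell_y a n = 1 + 1 * int n] (mod (a - 1))"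
    using a Suc by (intro cong_add cong_mult) auto
  ultimately show ?case by simp
qed simp

lemma pell_cong:
  assumes "[a = b] (mod m)"
  shows "[pell_x a n = pell_x b n] (mod m) \<and> [pell_y a n = pell_y b n] (mod m)"
proof (induction n)
  case (Suc n)
  then show ?case
    using assms by (auto intro!: cong_add cong_mult cong_diff cong_pow)
qed simp

text \<open>Modulo \<open>2 * a * n - n^2 - 1\<close> the number \<open>n\<close> is a root of
  \<open>t^2 - 2 * a * t + 1\<close>, as \<open>a + sqrt (a^2 - 1)\<close> is. So
  \<open>sqrt (a^2 - 1)\<close> may be replaced by \<open>n - a\<close> in the \<open>k\<close>-th
  power.\<close>

lemma pell_power_cong:
  "[pell_x a k - (a - n) * pell_y a k = n ^ k] (mod (2 * a * n - n\<^sup>2 - 1))"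
proof (induction k)
  case (Suc k)
  have "pell_x a (Suc k) - (a - n) * pell_y a (Suc k) =
      n * (pell_x a k - (a - n) * pell_y a k) + (2 * a * n - n\<^sup>2 - 1) * pell_y a k"
    by (simp add: algebra_simps power2_eq_square)
  moreover have "[n * (pell_x a k - (a - n) * pell_y a k) + (2 * a * n - n\<^sup>2 - 1) * pell_y a k
      = n * n ^ k + 0] (mod (2 * a * n - n\<^sup>2 - 1))"
    using Suc by (intro cong_add cong_mult cong_refl) (simp_all add: cong_0_iff)
  ultimately show ?case by simp
qed simp

section \<open>Diophantine descriptions of the Pell sequences and of powers\<close>

definition is_pell :: "nat \<Rightarrow> nat \<Rightarrow> nat \<Rightarrow> bool" where
  "is_pell a x y \<longleftrightarrow> x\<^sup>2 + y\<^sup>2 = a\<^sup>2 * y\<^sup>2 + 1"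

lemma is_pell_int: "is_pell a x y \<longleftrightarrow> (int x)\<^sup>2 = ((int a)\<^sup>2 - 1) * (int y)\<^sup>2 + 1"
proof -
  have "is_pell a x y \<longleftrightarrow> int (x\<^sup>2 + y\<^sup>2) = int (a\<^sup>2 * y\<^sup>2 + 1)"
    unfolding is_pell_def of_nat_eq_iff ..
  then show ?thesis by (auto simp: algebra_simps)
qed

lemma is_pell_iff:
  assumes "2 \<le> a"
  shows "is_pell a x y \<longleftrightarrow> (\<exists>n. int x = pell_x (int a) n \<and> int y = pell_y (int a) n)"
  using pell_solutions[of "int a" "int x" "int y"] assms pell_eq[of "int a"]
  by (auto simp: is_pell_int)

definition pell_xn :: "nat \<Rightarrow> nat \<Rightarrow> nat" where "pell_xn a n = nat (pell_x (int a) n)"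
definition pell_yn :: "nat \<Rightarrow> nat \<Rightarrow> nat" where "pell_yn a n = nat (pell_y (int a) n)"

lemma int_pell_xn: "1 \<le> a \<Longrightarrow> int (pell_xn a n) = pell_x (int a) n"
  and int_pell_yn: "1 \<le> a \<Longrightarrow> int (pell_yn a n) = pell_y (int a) n"
  using pell_nonneg[of "int a" n] by (simp_all add: pell_xn_def pell_yn_def)

text \<open>
  For \<open>x, y\<close> and \<open>s, t\<close> of index \<open>i\<close> (base \<open>a\<close>) and \<open>j\<close> (base \<open>b\<close>): the congruences modulo \<open>u\<close>
  together with \<open>y\<^sup>2 dvd v\<close> force \<open>j = \<plusminus> i\<close> modulo \<open>2 y\<close>, and those modulo \<open>2 y\<close> force \<open>j = k\<close>.
\<close>

definition pell_witness :: "nat \<Rightarrow> nat \<Rightarrow> nat \<Rightarrow> nat \<Rightarrow> nat \<Rightarrow> nat \<Rightarrow> nat \<Rightarrow> nat \<Rightarrow> nat \<Rightarrow> bool"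
  where "pell_witness a k x y u v b s t \<longleftrightarrow>
    is_pell a x y \<and> is_pell a u v \<and> is_pell b s t \<and> 2 \<le> b \<and> 0 < v \<and> y * y dvd v \<and>
    [b = 1] (mod 2 * y) \<and> [b = a] (mod u) \<and> [s = x] (mod u) \<and> [t = k] (mod 2 * y) \<and> k \<le> y"

lemma pell_witness_sound:
  assumes "2 \<le> a" "1 \<le> k" "pell_witness a k x y u v b s t"
  shows "x = pell_xn a k \<and> y = pell_yn a k"
proof -
  note w = assms(3)[unfolded pell_witness_def]
  let ?a = "int a" and ?b = "int b"
  have a: "2 \<le> ?a" "2 \<le> ?b" using assms w by auto
  obtain i where i: "int x = pell_x ?a i" "int y = pell_y ?a i" using w is_pell_iff assms by blast
  obtain n where n: "int u = pell_x ?a n" "int v = pell_y ?a n" using w is_pell_iff assms by blast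
  obtain j where j: "int s = pell_x ?b j" "int t = pell_y ?b j" using w is_pell_iff by blast
  have y: "0 < y" using w assms by linarith
  have ipos: "0 < i" using y i by (cases i) auto
  \<comment> \<open>The bound \<open>y <= v\<close> gives \<open>i <= n\<close>, which
    \<open>pell_x_cong_imp\<close> requires.\<close>
  have "y * 1 \<le> y * y" using y by (intro mult_le_mono2) simp
  also have "y * y \<le> v" using w by (simp add: dvd_imp_le)
  finally have "y \<le> v" by simp
  then have "i \<le> n" using pell_y_strict_mono[OF a(1), of n i] i n by (metis not_le of_nat_le_iff)
  have "0 < n" using \<open>i \<le> n\<close> ipos by simp
  have "(pell_y ?a i)\<^sup>2 dvd pell_y ?a n"
    using w i n by (metis of_nat_dvd_iff of_nat_mult power2_eq_square)
  then have "pell_y ?a i dvd pell_y ?a n" by (metis dvd_mult_left power2_eq_square)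
  then have "i dvd n" using pell_y_dvd_imp_dvd a ipos by blast
  then obtain q where q: "n = i * q" by blast
  have "pell_y ?a i dvd int q"
    using pell_y_sq_dvd_iff[of ?a i q] \<open>(pell_y ?a i)\<^sup>2 dvd _\<close> y i q by simp
  \<comment> \<open>Now congruences of indices modulo \<open>2 * n\<close> descend to the modulus
    \<open>2 * y\<close>, which is visible in the values.\<close>
  then have yn: "2 * int y dvd 2 * int n" using i q by simp
  have "[pell_x ?a j = pell_x ?b j] (mod int u)"
    using pell_cong w by (metis cong_int_iff cong_sym)
  moreover have "[pell_x ?b j = pell_x ?a i] (mod int u)"
    using w i j by (metis cong_int_iff)
  ultimately have "[pell_x ?a j = pell_x ?a i] (mod pell_x ?a n)"
    using n cong_trans by metis
  from pell_x_cong_imp[OF a(1) \<open>i \<le> n\<close> \<open>0 < n\<close> this]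
  have ji: "[int j = int i] (mod (2 * int y)) \<or> [int j = - int i] (mod (2 * int y))"
    using yn cong_dvd_modulus by blast
  have "[?b = int 1] (mod int (2 * y))" using w cong_int_iff by blast
  then have "2 * int y dvd ?b - 1" by (simp add: cong_iff_dvd_diff)
  then have "[int t = int j] (mod (2 * int y))"
    using pell_y_cong_index[of ?b j] j cong_dvd_modulus by metis
  moreover have "[int t = int k] (mod (2 * int y))"
    using w cong_int_iff[of t k "2 * y"] by simp
  ultimately have "[int k = int j] (mod (2 * int y))" using cong_sym cong_trans by blast
  then have ki: "[int k = int i] (mod (2 * int y)) \<or> [int k = - int i] (mod (2 * int y))"
    using ji cong_trans by blast
  have iy: "i \<le> y" using pell_y_ge[OF a(1), of i] i by simp
  have ky: "k \<le> y" "0 < k" using w assms by auto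
  have "k = i"
    using ki
  proof
    assume "[int k = int i] (mod (2 * int y))"
    then have "2 * int y dvd \<bar>int k - int i\<bar>" by (simp add: cong_iff_dvd_diff)
    moreover have "\<bar>int k - int i\<bar> < 2 * int y" using iy ky ipos by linarith
    ultimately have "\<bar>int k - int i\<bar> = 0"
      using zdvd_imp_le[of "2 * int y" "\<bar>int k - int i\<bar>"] by linarith
    then show ?thesis by simp
  next
    \<comment> \<open>As \<open>0 < k + i <= 2 * y\<close>, divisibility by \<open>2 * y\<close>
      leaves only \<open>k = i = y\<close>.\<close>
    assume "[int k = - int i] (mod (2 * int y))"
    then have "2 * int y dvd int k + int i" by (simp add: cong_iff_dvd_diff)
    then have "2 * int y \<le> int k + int i" using ky by (intro zdvd_imp_le) auto
    then show ?thesis using iy ky by simp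
  qed
  then show ?thesis using i by (simp add: pell_xn_def pell_yn_def flip: i)
qed

lemma pell_witness_complete:
  assumes "2 \<le> a" "1 \<le> k"
  shows "\<exists>u v b s t. pell_witness a k (pell_xn a k) (pell_yn a k) u v b s t"
proof -
  let ?a = "int a"
  have a: "2 \<le> ?a" using assms by simp
  define x where "x = pell_xn a k"
  define y where "y = pell_yn a k"
  \<comment> \<open>The factor \<open>y\<close> makes \<open>y * y\<close> divide \<open>v\<close>;
    the factor 2 makes \<open>u\<close> odd, hence coprime to \<open>2 * y\<close>, as the Chinese
    remainder theorem needs for \<open>b\<close>.\<close>
  define n where "n = k * (2 * y)"
  define u where "u = pell_xn a n"
  define v where "v = pell_yn a n"
  have xy: "int x = pell_x ?a k" "int y = pell_y ?a k" "int u = pell_x ?a n" "int v = pell_y ?a n"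
    unfolding x_def y_def u_def v_def using assms by (simp_all add: int_pell_xn int_pell_yn)
  have ky: "k \<le> y" using pell_y_ge[OF a, of k] xy by simp
  then have y: "0 < y" using assms by simp
  have "(pell_y ?a k)\<^sup>2 dvd pell_y ?a n"
    unfolding n_def using pell_y_sq_dvd_iff[of ?a k "2 * y"] y xy by simp
  then have "int (y\<^sup>2) dvd int v" using xy by simp
  then have yv: "y * y dvd v" unfolding of_nat_dvd_iff power2_eq_square .
  have npos: "0 < n" using y assms by (simp add: n_def)
  have v: "0 < v" using pell_y_ge[OF a, of n] npos xy by linarith
  have "coprime (int u) (int v)" using coprime_pell xy by simp
  then have "coprime u v" by (simp add: coprime_int_iff)
  then have "coprime u y" using yv by (meson coprime_divisors dvd_mult_left dvd_refl)
  moreover have "odd u"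
  proof -
    have "n = 2 * (k * y)" by (simp add: n_def)
    then have "int u = 2 * (pell_x ?a (k * y))\<^sup>2 - 1" using pell_double(1) xy by metis
    then have "odd (int u)" by simp
    then show ?thesis by simp
  qed
  ultimately have "coprime u (2 * y)" by simp
  then obtain b0 where b0: "[b0 = a] (mod u)" "[b0 = 1] (mod 2 * y)"
    using binary_chinese_remainder_nat by blast
  \<comment> \<open>The added multiple of \<open>u\<close> and \<open>2 * y\<close> keeps both
    residues and ensures \<open>2 <= b\<close>.\<close>
  define b where "b = b0 + 4 * (u * y)"
  have "b = b0 + u * (4 * y)" "b = b0 + 2 * y * (2 * u)" by (simp_all add: b_def)
  then have "[b = b0] (mod u)" "[b = b0] (mod 2 * y)"
    unfolding cong_def by (metis mod_mult_self2)+
  then have b: "[b = a] (mod u)" "[b = 1] (mod 2 * y)" using b0 cong_trans by blast+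
  have "0 < u" using \<open>odd u\<close> by (rule odd_pos)
  then have "0 < u * y" using y by simp
  then have b2: "2 \<le> b" unfolding b_def by linarith 
  define s where "s = pell_xn b k"
  define t where "t = pell_yn b k"
  have st: "int s = pell_x (int b) k" "int t = pell_y (int b) k"
    unfolding s_def t_def using b2 by (simp_all add: int_pell_xn int_pell_yn)
  have "[int s = int x] (mod int u)"
    unfolding st xy(1) using pell_cong b(1) cong_int_iff by blast
  then have su: "[s = x] (mod u)" by (simp add: cong_int_iff)
  have "[int b = int 1] (mod int (2 * y))" using b cong_int_iff by blast
  then have "int (2 * y) dvd int b - 1" by (simp add: cong_iff_dvd_diff)
  then have "[int t = int k] (mod int (2 * y))"
    using pell_y_cong_index[of "int b" k] st cong_dvd_modulus by metis
  then have "[t = k] (mod 2 * y)" using cong_int_iff by blast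
  then have "pell_witness a k x y u v b s t"
    unfolding pell_witness_def using is_pell_iff[OF assms(1)] is_pell_iff[OF b2] xy st v yv b b2 su ky
    by blast
  then show ?thesis unfolding x_def y_def by blast
qed

lemma pell_iff_witness:
  assumes "2 \<le> a" "1 \<le> k"
  shows "x = pell_xn a k \<and> y = pell_yn a k \<longleftrightarrow> (\<exists>u v b s t. pell_witness a k x y u v b s t)"
  using pell_witness_sound[OF assms] pell_witness_complete[OF assms] by blast

lemma pell_xn_ge: "(n + 2) ^ Suc k \<le> pell_xn (n + 2) (Suc k)" "n + 2 \<le> pell_xn (n + 2) (Suc k)"
proof -
  have "int (n + 2) ^ Suc k \<le> pell_x (int (n + 2)) (Suc k)"
    by (intro pell_x_ge_power) auto
  also have "\<dots> = int (pell_xn (n + 2) (Suc k))" by (simp add: int_pell_xn del: pell_x.simps)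
  finally have "int ((n + 2) ^ Suc k) \<le> int (pell_xn (n + 2) (Suc k))" by (simp only: of_nat_power)
  then show ge: "(n + 2) ^ Suc k \<le> pell_xn (n + 2) (Suc k)" unfolding of_nat_le_iff .
  have "(n + 2) ^ 1 \<le> (n + 2) ^ Suc k" by (intro power_increasing) auto
  then show "n + 2 \<le> pell_xn (n + 2) (Suc k)" using ge by simp
qed

text \<open>The base \<open>pell_xn (n + 2) (Suc k)\<close> exceeds \<open>n ^ k\<close>, so that the congruence determines the power.\<close>

lemma power_iff_pell:
  assumes "1 \<le> n" "a = pell_xn (n + 2) (Suc k)"
  shows "m = n ^ k \<longleftrightarrow>
    m < a \<and> [pell_xn a k + pell_yn a k * n = m + pell_yn a k * a] (mod 2 * a * n - n\<^sup>2 - 1)"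
proof -
  have ge: "(n + 2) ^ Suc k \<le> a" and na: "n + 2 \<le> a" using pell_xn_ge assms(2) by auto
  have "n ^ k \<le> (n + 2) ^ k" by (intro power_mono) auto
  also have "\<dots> < (n + 2) ^ Suc k" by simp
  finally have lt: "n ^ k < a" using ge by simp
  define M where "M = 2 * a * n - n\<^sup>2 - 1"
  \<comment> \<open>The modulus is at least \<open>a\<close>, so it separates numbers below
    \<open>a\<close>, and its natural subtractions do not truncate.\<close>
  have "n * n + a + 1 \<le> 2 * a * n"
  proof -
    have "n * n + 2 * n \<le> n * a" using mult_le_mono2[OF na, of n] by (simp add: algebra_simps)
    moreover have "a \<le> n * a" using assms(1) by simp
    moreover have "2 * a * n = n * a + n * a" by simp
    ultimately show ?thesis using assms(1) by linarith
  qed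
  then have M: "M + n\<^sup>2 + 1 = 2 * a * n" "a \<le> M" by (auto simp: M_def power2_eq_square)
  have a1: "1 \<le> a" using na by simp
  have iM: "int M = 2 * int a * int n - (int n)\<^sup>2 - 1"
    using arg_cong[OF M(1), of int] by simp
  have "[pell_x (int a) k - (int a - int n) * pell_y (int a) k = int n ^ k] (mod int M)"
    unfolding iM by (rule pell_power_cong)
  then have "[pell_x (int a) k - (int a - int n) * pell_y (int a) k + pell_y (int a) k * int a =
      int n ^ k + pell_y (int a) k * int a] (mod int M)"
    by (rule cong_add) simp
  then have "[int (pell_xn a k + pell_yn a k * n) = int (n ^ k + pell_yn a k * a)] (mod int M)"
    using a1 by (simp add: int_pell_xn int_pell_yn algebra_simps)
  then have cong: "[pell_xn a k + pell_yn a k * n = n ^ k + pell_yn a k * a] (mod M)"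
    by (simp only: cong_int_iff)
  show ?thesis unfolding M_def[symmetric]
  proof
    assume "m = n ^ k"
    then show "m < a \<and> [pell_xn a k + pell_yn a k * n = m + pell_yn a k * a] (mod M)"
      using lt cong by simp
  next
    assume m: "m < a \<and> [pell_xn a k + pell_yn a k * n = m + pell_yn a k * a] (mod M)"
    then have "[m + pell_yn a k * a = n ^ k + pell_yn a k * a] (mod M)"
      using cong cong_sym cong_trans by blast
    then have "[m = n ^ k] (mod M)" by (simp add: cong_add_rcancel_nat)
    then show "m = n ^ k" using m lt M(2) by (intro cong_less_modulus_unique_nat[of m "n ^ k" M]) auto
  qed
qed

section \<open>Diophantine relations and functions\<close>

datatype 'v pexp = Var 'v | Const nat | Add "'v pexp" "'v pexp" | Mul "'v pexp" "'v pexp"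

text \<open>Evaluation in an arbitrary commutative semiring lets one expression be read both in
  natural numbers and in profiles. There is no subtraction, so equations always have two
  sides.\<close>

primrec peval :: "'v pexp \<Rightarrow> ('v \<Rightarrow> 'a::comm_semiring_1) \<Rightarrow> 'a" where
  "peval (Var x) e = e x"
| "peval (Const n) e = of_nat n"
| "peval (Add p q) e = peval p e + peval q e"
| "peval (Mul p q) e = peval p e * peval q e"

lemma peval_map: "peval (map_pexp f p) e = peval p (\<lambda>x. e (f x))"
  by (induction p) simp_all

text \<open>
  Relations between finitely many natural numbers are predicates on sequences; \<open>Inl\<close> marks the
  parameters of a Diophantine equation and \<open>Inr\<close> its unknowns.
\<close>

definition dioph :: "((nat \<Rightarrow> nat) \<Rightarrow> bool) \<Rightarrow> bool" where
  "dioph R \<longleftrightarrow> (\<exists>p q :: (nat + nat) pexp. \<forall>v.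
    R v \<longleftrightarrow> (\<exists>w. peval p (case_sum v w) = peval q (case_sum v w)))"

definition dfun :: "((nat \<Rightarrow> nat) \<Rightarrow> nat) \<Rightarrow> bool" where
  "dfun f \<longleftrightarrow> dioph (\<lambda>v. v 0 = f (\<lambda>i. v (Suc i)))"

lemma diophI:
  fixes p q :: "(nat + nat) pexp"
  assumes "\<And>v. R v \<longleftrightarrow> (\<exists>w. peval p (case_sum v w) = peval q (case_sum v w))"
  shows "dioph R"
  using assms unfolding dioph_def by blast

lemma diophE:
  assumes "dioph R"
  obtains p q :: "(nat + nat) pexp"
  where "\<And>v. R v \<longleftrightarrow> (\<exists>w. peval p (case_sum v w) = peval q (case_sum v w))"
  using assms unfolding dioph_def by blast

section \<open>Closure under renaming, existential quantifiers and connectives\<close>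

lemma dioph_rename:
  assumes "dioph R"
  shows "dioph (\<lambda>v. R (\<lambda>i. v (r i)))"
proof -
  obtain p q :: "(nat + nat) pexp" where
    R: "\<And>v. R v \<longleftrightarrow> (\<exists>w. peval p (case_sum v w) = peval q (case_sum v w))"
    using assms by (rule diophE) blast
  have "(\<lambda>x. case_sum v w (map_sum r id x)) = case_sum (\<lambda>i. v (r i)) w" for v w :: "nat \<Rightarrow> nat"
    by (rule ext) (simp split: sum.splits)
  then show ?thesis
    by (intro diophI[of _ "map_pexp (map_sum r id) p" "map_pexp (map_sum r id) q"])
      (simp add: R peval_map)
qed

definition interleave :: "(nat \<Rightarrow> nat) \<Rightarrow> (nat \<Rightarrow> nat) \<Rightarrow> nat \<Rightarrow> nat" where
  "interleave x y i = (if even i then x (i div 2) else y (i div 2))"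

lemma interleave_simps [simp]:
  "interleave x y (2 * i) = x i" "interleave x y (Suc (2 * i)) = y i"
  by (simp_all add: interleave_def)

lemma ex_interleave:
  fixes P :: "(nat \<Rightarrow> nat) \<Rightarrow> (nat \<Rightarrow> nat) \<Rightarrow> bool"
  shows "(\<exists>w. P (\<lambda>i. w (2 * i)) (\<lambda>i. w (Suc (2 * i)))) \<longleftrightarrow> (\<exists>x y. P x y)"
proof
  assume "\<exists>x y. P x y"
  then obtain x y where "P x y" by blast
  then show "\<exists>w. P (\<lambda>i. w (2 * i)) (\<lambda>i. w (Suc (2 * i)))"
    by (intro exI[of _ "interleave x y"]) simp
qed blast

text \<open>Parameters at odd places are turned into unknowns. Quantifying a whole sequence at once
  serves where a fixed but arbitrary number of unknowns is needed.\<close>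

lemma dioph_ex_seq:
  assumes "dioph (\<lambda>v. R (\<lambda>i. v (2 * i)) (\<lambda>i. v (Suc (2 * i))))"
  shows "dioph (\<lambda>v. \<exists>w. R v w)"
proof -
  obtain p q :: "(nat + nat) pexp" where
    pq: "\<And>v. R (\<lambda>i. v (2 * i)) (\<lambda>i. v (Suc (2 * i))) \<longleftrightarrow>
      (\<exists>w. peval p (case_sum v w) = peval q (case_sum v w))"
    using assms by (rule diophE) blast
  \<comment> \<open>Quantified parameters go to the even unknowns, the old unknowns to the odd
    ones.\<close>
  define f :: "nat + nat \<Rightarrow> nat + nat" where
    "f = case_sum (\<lambda>i. if even i then Inl (i div 2) else Inr (2 * (i div 2))) (\<lambda>i. Inr (Suc (2 * i)))"
  have R: "R v x \<longleftrightarrow> (\<exists>w. peval p (case_sum (interleave v x) w) =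
      peval q (case_sum (interleave v x) w))" for v x
    using pq[of "interleave v x"] by simp
  have f: "(\<lambda>x. case_sum v w (f x)) =
      case_sum (interleave v (\<lambda>i. w (2 * i))) (\<lambda>i. w (Suc (2 * i)))" for v w :: "nat \<Rightarrow> nat"
    by (rule ext) (simp add: f_def interleave_def split: sum.splits)
  show ?thesis
    by (rule diophI[of _ "map_pexp f p" "map_pexp f q"])
      (simp add: R peval_map f ex_interleave[of "\<lambda>x w. peval p (case_sum (interleave _ x) w) =
        peval q (case_sum (interleave _ x) w)"])
qed

lemma dioph_ex:
  assumes "dioph (\<lambda>v. R (\<lambda>i. v (Suc i)) (v 0))"
  shows "dioph (\<lambda>v. \<exists>x. R v x)"
proof -
  have "dioph (\<lambda>v. \<exists>w :: nat \<Rightarrow> nat. R v (w 0))"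
    by (rule dioph_ex_seq[of "\<lambda>v w. R v (w 0)"])
      (use dioph_rename[OF assms, of "case_nat 1 (\<lambda>i. 2 * i)"] in simp)
  moreover have "(\<exists>w :: nat \<Rightarrow> nat. R v (w 0)) \<longleftrightarrow> (\<exists>x. R v x)" for v
    by (auto intro: exI[of _ "\<lambda>_. _"])
  ultimately show ?thesis by simp
qed

text \<open>Over the integers these are \<open>(a - b)^2 + (c - d)^2 = 0\<close> and
  \<open>(a - b) * (c - d) = 0\<close>, with the negative terms moved across. The unknowns of the
  two equations are kept apart by parity.\<close>

lemma dioph_conj_disj:
  assumes "dioph R" "dioph S"
  shows dioph_conj: "dioph (\<lambda>v. R v \<and> S v)" and dioph_disj: "dioph (\<lambda>v. R v \<or> S v)"
proof -
  obtain p q :: "(nat + nat) pexp" where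
    R: "\<And>v. R v \<longleftrightarrow> (\<exists>w. peval p (case_sum v w) = peval q (case_sum v w))"
    using assms(1) by (rule diophE) blast
  obtain p' q' :: "(nat + nat) pexp" where
    S: "\<And>v. S v \<longleftrightarrow> (\<exists>w. peval p' (case_sum v w) = peval q' (case_sum v w))"
    using assms(2) by (rule diophE) blast
  define l :: "nat + nat \<Rightarrow> nat + nat" where "l = map_sum id (\<lambda>i. 2 * i)"
  define r :: "nat + nat \<Rightarrow> nat + nat" where "r = map_sum id (\<lambda>i. Suc (2 * i))"
  have l: "(\<lambda>x. case_sum v w (l x)) = case_sum v (\<lambda>i. w (2 * i))"
    and r: "(\<lambda>x. case_sum v w (r x)) = case_sum v (\<lambda>i. w (Suc (2 * i)))" for v w :: "nat \<Rightarrow> nat"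
    by (rule ext, simp add: l_def r_def split: sum.splits)+
  let ?p = "map_pexp l p" and ?q = "map_pexp l q" and ?p' = "map_pexp r p'" and ?q' = "map_pexp r q'"
  have conj_iff: "a * a + b * b + (c * c + d * d) = 2 * (a * b) + 2 * (c * d) \<longleftrightarrow> a = b \<and> c = d"
    for a b c d :: nat
  proof -
    have "a * a + b * b + (c * c + d * d) = 2 * (a * b) + 2 * (c * d) \<longleftrightarrow>
        (int a - int b)\<^sup>2 + (int c - int d)\<^sup>2 = 0"
      unfolding of_nat_eq_iff[where 'a = int, symmetric]
      by (simp add: power2_eq_square algebra_simps)
    then show ?thesis by (simp add: sum_power2_eq_zero_iff)
  qed
  have disj_iff: "a * c + b * d = a * d + b * c \<longleftrightarrow> a = b \<or> c = d" for a b c d :: nat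
  proof -
    have "a * c + b * d = a * d + b * c \<longleftrightarrow> (int a - int b) * (int c - int d) = 0"
      unfolding of_nat_eq_iff[where 'a = int, symmetric]
      by (auto simp: algebra_simps)
    then show ?thesis by simp
  qed
  show "dioph (\<lambda>v. R v \<and> S v)"
  proof (rule diophI)
    fix v
    show "R v \<and> S v \<longleftrightarrow> (\<exists>w.
      peval (Add (Add (Mul ?p ?p) (Mul ?q ?q)) (Add (Mul ?p' ?p') (Mul ?q' ?q'))) (case_sum v w) =
      peval (Add (Mul (Const 2) (Mul ?p ?q)) (Mul (Const 2) (Mul ?p' ?q'))) (case_sum v w))"
      unfolding R S peval.simps peval_map l r
      using ex_interleave[of "\<lambda>w w'. peval p (case_sum v w) = peval q (case_sum v w) \<and>
          peval p' (case_sum v w') = peval q' (case_sum v w')"]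
      by (simp add: conj_iff)
  qed
  show "dioph (\<lambda>v. R v \<or> S v)"
  proof (rule diophI)
    fix v
    show "R v \<or> S v \<longleftrightarrow> (\<exists>w.
      peval (Add (Mul ?p ?p') (Mul ?q ?q')) (case_sum v w) =
      peval (Add (Mul ?p ?q') (Mul ?q ?p')) (case_sum v w))"
      unfolding R S peval.simps peval_map l r
      using ex_interleave[of "\<lambda>w w'. peval p (case_sum v w) = peval q (case_sum v w) \<or>
          peval p' (case_sum v w') = peval q' (case_sum v w')"]
      by (simp add: disj_iff)
  qed
qed

lemma dioph_True: "dioph (\<lambda>v. True)"
  by (rule diophI[of _ "Const 0" "Const 0"]) simp

lemma dioph_False: "dioph (\<lambda>v. False)"
  by (rule diophI[of _ "Const 0" "Const 1"]) simp

lemma dioph_ball_lessThan: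
  fixes n :: nat
  assumes "\<And>i. i < n \<Longrightarrow> dioph (R i)"
  shows "dioph (\<lambda>v. \<forall>i<n. R i v)"
  using assms
proof (induction n)
  case (Suc n)
  have "dioph (\<lambda>v. (\<forall>i<n. R i v) \<and> R n v)" using Suc by (intro dioph_conj) auto
  moreover have "(\<forall>i<Suc n. R i v) \<longleftrightarrow> (\<forall>i<n. R i v) \<and> R n v" for v
    by (auto simp: less_Suc_eq)
  ultimately show ?case by simp
qed (simp add: dioph_True)

section \<open>Substitution and arithmetic of Diophantine functions\<close>

lemma dfun_rename: "dfun f \<Longrightarrow> dfun (\<lambda>v. f (\<lambda>i. v (r i)))"
  unfolding dfun_def
  by (drule dioph_rename[of _ "case_nat 0 (\<lambda>i. Suc (r i))"]) simp

lemma dioph_subst: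
  assumes "dfun f" "dioph (\<lambda>v. R (\<lambda>i. v (Suc i)) (v 0))"
  shows "dioph (\<lambda>v. R v (f v))"
proof -
  have "dioph (\<lambda>v. \<exists>x. x = f v \<and> R v x)"
    using assms unfolding dfun_def by (intro dioph_ex dioph_conj)
  then show ?thesis by simp
qed

lemma dioph_subst2:
  assumes "dioph (\<lambda>v. P (v 0) (v 1))" "dfun f" "dfun g"
  shows "dioph (\<lambda>v. P (f v) (g v))"
proof (rule dioph_subst[OF assms(2), where R = "\<lambda>v x. P x (g v)"],
    rule dioph_subst[where R = "\<lambda>v. P (v 0)"])
  show "dfun (\<lambda>v. g (\<lambda>i. v (Suc i)))" using assms(3) by (rule dfun_rename)
  show "dioph (\<lambda>v. P (v (Suc 0)) (v 0))"
    using dioph_rename[OF assms(1), of "\<lambda>i. if i = 0 then 1 else 0"] by simp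
qed

lemma dioph_subst3:
  assumes "dioph (\<lambda>v. P (v 0) (v 1) (v 2))" "dfun f" "dfun g" "dfun h"
  shows "dioph (\<lambda>v. P (f v) (g v) (h v))"
proof -
  \<comment> \<open>The renaming reverses the first three places, so that \<open>h\<close>,
    \<open>g\<close> and \<open>f\<close> can be substituted for place 0 in turn.\<close>
  have "dioph (\<lambda>v. P (v (Suc (Suc 0))) (v (Suc 0)) (v 0))"
    using dioph_rename[OF assms(1), of "\<lambda>i. 2 - i"] by (simp add: numeral_2_eq_2)
  then have "dioph (\<lambda>v. P (v (Suc 0)) (v 0) (h (\<lambda>i. v (Suc (Suc i)))))"
    by (rule dioph_subst[rotated]) (rule dfun_rename[OF assms(4)])
  then have "dioph (\<lambda>v. P (v 0) (g (\<lambda>i. v (Suc i))) (h (\<lambda>i. v (Suc i))))"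
    by (rule dioph_subst[rotated, where R = "\<lambda>v x. P (v 0) x (h (\<lambda>i. v (Suc i)))"])
      (rule dfun_rename[OF assms(3)])
  then show ?thesis
    by (rule dioph_subst[OF assms(2), where R = "\<lambda>v x. P x (g v) (h v)"])
qed

lemma dfun_subst2:
  assumes "dfun (\<lambda>v. h (v 0) (v 1))" "dfun f" "dfun g"
  shows "dfun (\<lambda>v. h (f v) (g v))"
  unfolding dfun_def
proof (rule dioph_subst[where R = "\<lambda>v x. v 0 = h x (g (\<lambda>i. v (Suc i)))", OF dfun_rename[OF assms(2)]],
    rule dioph_subst[where R = "\<lambda>v x. v (Suc 0) = h (v 0) x", OF dfun_rename[OF assms(3)]])
  show "dioph (\<lambda>v. v (Suc (Suc 0)) = h (v (Suc 0)) (v 0))"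
    using dioph_rename[OF assms(1)[unfolded dfun_def], of "\<lambda>i. 2 - i"] by (simp add: numeral_2_eq_2)
qed

lemma dfun_var: "dfun (\<lambda>v. v i)"
  unfolding dfun_def by (rule diophI[of _ "Var (Inl 0)" "Var (Inl (Suc i))"]) simp

lemma dfun_const: "dfun (\<lambda>v. n)"
  unfolding dfun_def by (rule diophI[of _ "Var (Inl 0)" "Const n"]) simp

lemma dfun_add: "dfun f \<Longrightarrow> dfun g \<Longrightarrow> dfun (\<lambda>v. f v + g v)"
  by (rule dfun_subst2[where h = "(+)"], unfold dfun_def,
      rule diophI[of _ "Var (Inl 0)" "Add (Var (Inl 1)) (Var (Inl 2))"]) (simp add: numeral_2_eq_2)

lemma dfun_mult: "dfun f \<Longrightarrow> dfun g \<Longrightarrow> dfun (\<lambda>v. f v * g v)"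
  by (rule dfun_subst2[where h = "(*)"], unfold dfun_def,
      rule diophI[of _ "Var (Inl 0)" "Mul (Var (Inl 1)) (Var (Inl 2))"]) (simp add: numeral_2_eq_2)

lemma dfun_Suc: "dfun f \<Longrightarrow> dfun (\<lambda>v. Suc (f v))"
  using dfun_add[OF dfun_const[of 1]] by simp

lemma dioph_eq: "dfun f \<Longrightarrow> dfun g \<Longrightarrow> dioph (\<lambda>v. f v = g v)"
  by (rule dioph_subst2[where P = "(=)"], rule diophI[of _ "Var (Inl 0)" "Var (Inl 1)"]) simp

lemmas dioph_intros =
  dioph_eq dioph_conj dioph_disj dioph_ex dioph_True dioph_False
  dfun_var dfun_const dfun_add dfun_mult dfun_Suc

lemma dioph_le: "dfun f \<Longrightarrow> dfun g \<Longrightarrow> dioph (\<lambda>v. f v \<le> g v)"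
  by (rule dioph_subst2[where P = "(\<le>)"]) (unfold le_iff_add, intro dioph_intros)

lemma dioph_less: "dfun f \<Longrightarrow> dfun g \<Longrightarrow> dioph (\<lambda>v. f v < g v)"
  unfolding less_eq_Suc_le by (intro dioph_le dfun_Suc)

lemma dioph_dvd: "dfun f \<Longrightarrow> dfun g \<Longrightarrow> dioph (\<lambda>v. f v dvd g v)"
  by (rule dioph_subst2[where P = "(dvd)"]) (unfold dvd_def, intro dioph_intros)

lemma dioph_cong: "dfun f \<Longrightarrow> dfun g \<Longrightarrow> dfun h \<Longrightarrow> dioph (\<lambda>v. [f v = g v] (mod h v))"
  by (rule dioph_subst3[where P = cong]) (unfold cong_iff_lin_nat, intro dioph_intros)

lemma dfun_diff: "dfun f \<Longrightarrow> dfun g \<Longrightarrow> dfun (\<lambda>v. f v - g v)"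
proof (rule dfun_subst2[where h = "(-)"])
  have "z = x - y \<longleftrightarrow> x = z + y \<or> x < y \<and> z = 0" for x y z :: nat by auto
  then show "dfun (\<lambda>v. v 0 - v 1)"
    unfolding dfun_def by (simp only:) (intro dioph_intros dioph_less)
qed

lemma dfun_div: "dfun f \<Longrightarrow> dfun g \<Longrightarrow> dfun (\<lambda>v. f v div g v)"
proof (rule dfun_subst2[where h = "(div)"])
  have "z = x div y \<longleftrightarrow> y = 0 \<and> z = 0 \<or> (\<exists>r. r < y \<and> x = z * y + r)" for x y z :: nat
    by (cases "y = 0") (auto intro!: exI[of _ "x mod y"])
  then show "dfun (\<lambda>v. v 0 div v 1)"
    unfolding dfun_def by (simp only:) (intro dioph_intros dioph_less)
qed

lemma dfun_mod: "dfun f \<Longrightarrow> dfun g \<Longrightarrow> dfun (\<lambda>v. f v mod g v)"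
  unfolding minus_mult_div_eq_mod[symmetric] by (intro dfun_diff dfun_mult dfun_div)

text \<open>Adding 2 to the base guarantees the hypothesis of \<open>pell_iff_witness\<close>; index
  0 is outside that lemma and is treated as a separate alternative.\<close>

lemma dfun_pell:
  assumes "dfun f" "dfun g"
  shows dfun_pell_xn: "dfun (\<lambda>v. pell_xn (f v + 2) (g v))"
    and dfun_pell_yn: "dfun (\<lambda>v. pell_yn (f v + 2) (g v))"
proof -
  have wit: "dioph (\<lambda>v. pell_witness (fa v) (fk v) (fx v) (fy v) (v i1) (v i2) (v i3) (v i4) (v i5))"
    if "dfun fa" "dfun fk" "dfun fx" "dfun fy" for fa fk fx fy i1 i2 i3 i4 i5
    unfolding pell_witness_def is_pell_def power2_eq_square
    by (intro that dioph_intros dioph_le dioph_less dioph_dvd dioph_cong)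
  have ge: "2 \<le> a + 2" for a :: nat by simp
  have x: "z = pell_xn (a + 2) k \<longleftrightarrow> k = 0 \<and> z = 1 \<or>
      1 \<le> k \<and> (\<exists>y u v b s t. pell_witness (a + 2) k z y u v b s t)"
    and y: "z = pell_yn (a + 2) k \<longleftrightarrow> k = 0 \<and> z = 0 \<or>
      1 \<le> k \<and> (\<exists>x u v b s t. pell_witness (a + 2) k x z u v b s t)" for z a k
    using pell_iff_witness[OF ge[of a], of k]
    by (cases "k = 0"; simp add: pell_xn_def[of _ 0] pell_yn_def[of _ 0]; blast)+
  show "dfun (\<lambda>v. pell_xn (f v + 2) (g v))"
    unfolding dfun_def x
    by (intro dioph_intros dioph_le wit dfun_rename[OF assms(1)] dfun_rename[OF assms(2)])
  show "dfun (\<lambda>v. pell_yn (f v + 2) (g v))"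
    unfolding dfun_def y
    by (intro dioph_intros dioph_le wit dfun_rename[OF assms(1)] dfun_rename[OF assms(2)])
qed

section \<open>Powers, binomial coefficients and factorials\<close>

lemma dfun_power: "dfun f \<Longrightarrow> dfun g \<Longrightarrow> dfun (\<lambda>v. f v ^ g v)"
proof (rule dfun_subst2[where h = "(^)"])
  \<comment> \<open>The Pell base is written as \<open>a + 2\<close> to fit
    \<open>dfun_pell\<close>; \<open>n = 0\<close> is separate because \<open>power_iff_pell\<close>
    needs \<open>1 <= n\<close>.\<close>
  have "m = n ^ k \<longleftrightarrow> n = 0 \<and> k = 0 \<and> m = 1 \<or> n = 0 \<and> 1 \<le> k \<and> m = 0 \<or>
      1 \<le> n \<and> (\<exists>a. a + 2 = pell_xn (n + 2) (k + 1) \<and> m < a + 2 \<and>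
        [pell_xn (a + 2) k + pell_yn (a + 2) k * n = m + pell_yn (a + 2) k * (a + 2)]
          (mod (2 * (a + 2) * n - n * n - 1)))" for m n k :: nat
  proof (cases "n = 0")
    case True
    then show ?thesis by (cases k) auto
  next
    case False
    then have n: "1 \<le> n" by simp
    have "n + 2 \<le> pell_xn (n + 2) (k + 1)" using pell_xn_ge(2)[of n k] by simp
    then obtain a where a: "a + 2 = pell_xn (n + 2) (k + 1)"
      by (metis add.commute add_leE le_Suc_ex)
    let ?Q = "\<lambda>b. m < b + 2 \<and> [pell_xn (b + 2) k + pell_yn (b + 2) k * n =
      m + pell_yn (b + 2) k * (b + 2)] (mod (2 * (b + 2) * n - n * n - 1))"
    have "m = n ^ k \<longleftrightarrow> ?Q a"
      using power_iff_pell[OF n, of "a + 2" k m] a by (simp only: power2_eq_square Suc_eq_plus1)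
    also have "\<dots> \<longleftrightarrow> (\<exists>b. b + 2 = pell_xn (n + 2) (k + 1) \<and> ?Q b)"
      using a by (metis (no_types) add_right_cancel)
    finally show ?thesis using False n by blast
  qed
  then show "dfun (\<lambda>v. v 0 ^ v 1)"
    unfolding dfun_def by (simp only:)
      (intro dioph_intros dioph_le dioph_less dioph_cong dfun_diff dfun_pell_xn dfun_pell_yn)
qed

lemma digit_sum:
  fixes u :: nat
  assumes "\<And>j. j < m \<Longrightarrow> d j < u"
  shows "((\<Sum>j<m. d j * u ^ j) div u ^ k) mod u = (if k < m then d k else 0)"
  using assms
proof (induction k arbitrary: d m)
  case 0
  show ?case
  proof (cases m)
    case (Suc m')
    have "(\<Sum>j<m. d j * u ^ j) = d 0 + u * (\<Sum>j<m'. d (Suc j) * u ^ j)"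
      unfolding Suc sum.lessThan_Suc_shift by (simp add: sum_distrib_left mult_ac)
    then show ?thesis using 0[of 0] Suc by simp
  qed simp
next
  case (Suc k)
  show ?case
  proof (cases m)
    case (Suc m')
    have "(\<Sum>j<m. d j * u ^ j) = d 0 + u * (\<Sum>j<m'. d (Suc j) * u ^ j)"
      unfolding Suc sum.lessThan_Suc_shift by (simp add: sum_distrib_left mult_ac)
    moreover have "d 0 < u" using Suc.prems[of 0] Suc by simp
    ultimately have "(\<Sum>j<m. d j * u ^ j) div u = (\<Sum>j<m'. d (Suc j) * u ^ j)" by simp
    then show ?thesis
      using Suc.IH[of m' "\<lambda>j. d (Suc j)"] Suc.prems Suc by (simp add: div_mult2_eq)
  qed simp
qed

text \<open>The binomial theorem expands \<open>(u + 1) ^ n\<close> in base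
  \<open>u = 2 ^ n + 1\<close>, and every coefficient, being at most \<open>2 ^ n\<close>, is a
  genuine digit.\<close>

lemma choose_eq_digit: "n choose k = ((2 ^ n + 2) ^ n div (2 ^ n + 1) ^ k) mod (2 ^ n + 1)"
proof -
  define u :: nat where "u = 2 ^ n + 1"
  have "n choose j < u" for j
    using binomial_le_pow2[of n j] by (simp add: u_def)
  then have "((\<Sum>j<Suc n. (n choose j) * u ^ j) div u ^ k) mod u =
      (if k < Suc n then n choose k else 0)"
    by (rule digit_sum)
  also have "(\<Sum>j<Suc n. (n choose j) * u ^ j) = (u + 1) ^ n"
    unfolding binomial by (simp add: lessThan_Suc_atMost)
  finally show ?thesis by (auto simp: u_def)
qed

lemma dfun_choose: "dfun f \<Longrightarrow> dfun g \<Longrightarrow> dfun (\<lambda>v. f v choose g v)"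
  unfolding choose_eq_digit by (intro dioph_intros dfun_power dfun_div dfun_mod)

text \<open>The recursion of the falling factorial
  \<open>r * (r - 1) * ... * (r - k + 1) = fact k * (r choose k)\<close>.\<close>

lemma fact_choose_Suc: "fact (Suc k) * (r choose Suc k) = (r - k) * (fact k * (r choose k))"
proof -
  have "Suc k * (r choose Suc k) = (r - k) * (r choose k)"
    by (metis binomial_absorb_comp binomial_absorption mult.commute)
  then have "fact k * (Suc k * (r choose Suc k)) = fact k * ((r - k) * (r choose k))" by simp
  then show ?thesis by (simp only: fact_Suc of_nat_id mult_ac)
qed

lemma power_diff_le_fact_choose:
  assumes "k \<le> n"
  shows "(r - n) ^ k \<le> fact k * (r choose k)"
  using assms
proof (induction k)
  case (Suc k)
  then have "(r - n) * (r - n) ^ k \<le> (r - k) * (fact k * (r choose k))"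
    by (intro mult_le_mono) auto
  then show ?case by (simp only: fact_choose_Suc power_Suc)
qed simp

text \<open>Bernoulli's inequality for \<open>(s / (s + k)) ^ n\<close>, cleared of
  denominators.\<close>

lemma power_add_le:
  fixes s k n :: nat
  shows "(s + k) ^ n * (s + k) \<le> s ^ n * (s + k) + n * k * (s + k) ^ n"
proof (induction n)
  case (Suc n)
  have "s ^ n \<le> (s + k) ^ n" by (intro power_mono) auto
  then have "k * (s ^ n * (s + k)) \<le> k * ((s + k) ^ n * (s + k))" by (intro mult_le_mono) auto
  moreover have "(s + k) * ((s + k) ^ n * (s + k)) \<le>
      (s + k) * (s ^ n * (s + k) + n * k * (s + k) ^ n)"
    using Suc by (intro mult_le_mono) auto
  ultimately show ?case by (simp add: algebra_simps)
qed simp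

text \<open>The falling factorial \<open>fact n * C\<close> lies between \<open>(r - n) ^ n\<close>
  and \<open>r ^ n\<close>. Since \<open>r\<close> exceeds \<open>n^2 * (fact n + 1)\<close>,
  Bernoulli's inequality puts \<open>r ^ n\<close> below \<open>(fact n + 1) * C\<close>.\<close>

lemma fact_eq_div: "fact n = (2 * (n + 1) ^ (n + 2)) ^ n div ((2 * (n + 1) ^ (n + 2)) choose n)"
proof -
  define r where "r = 2 * (n + 1) ^ (n + 2)"
  define C where "C = r choose n"
  have "n + 1 \<le> (n + 1) ^ (n + 2)" by (rule self_le_power) auto
  then have nr: "n \<le> r" unfolding r_def by linarith
  have fn: "fact n \<le> (n + 1) ^ n"
    using fact_le_power[of n, where 'a = nat] power_mono[of n "n + 1" n] by simp
  have "n\<^sup>2 * (fact n + 1) \<le> n\<^sup>2 * (2 * (n + 1) ^ n)"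
    using fn fact_ge_1[of n, where 'a = nat] by (intro mult_le_mono2) linarith
  also have "\<dots> < (n + 1)\<^sup>2 * (2 * (n + 1) ^ n)" by (intro mult_strict_right_mono power_strict_mono) auto
  also have "\<dots> = r" by (simp only: r_def power_add mult_ac)
  finally have r: "n\<^sup>2 * (fact n + 1) < r" .
  have lower: "fact n * C \<le> r ^ n" unfolding C_def using binomial_fact_pow[of r n] by (simp add: mult.commute)
  have "r ^ n * r \<le> (r - n) ^ n * r + n * n * r ^ n"
    using power_add_le[of "r - n" n n] nr by simp
  also have "\<dots> \<le> fact n * C * r + n\<^sup>2 * r ^ n"
    unfolding C_def power2_eq_square using power_diff_le_fact_choose[of n n r] by (intro add_mono mult_le_mono) auto
  finally have "(fact n + 1) * (r ^ n * r) \<le> (fact n + 1) * (fact n * C * r + n\<^sup>2 * r ^ n)"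
    by (rule mult_le_mono2)
  also have "\<dots> = (fact n + 1) * fact n * C * r + n\<^sup>2 * (fact n + 1) * r ^ n" by (simp add: algebra_simps)
  also have "\<dots> < (fact n + 1) * fact n * C * r + r * r ^ n"
    using r by (intro add_strict_left_mono mult_strict_right_mono) auto
  finally have "fact n * r * r ^ n < fact n * r * ((fact n + 1) * C)" by (simp add: algebra_simps)
  then have "r ^ n < (fact n + 1) * C" by (metis mult_less_cancel1)
  then have "r ^ n div C = fact n"
    using lower by (intro div_nat_eqI) (simp_all add: mult.commute)
  then show ?thesis by (simp add: r_def C_def)
qed

lemma dfun_fact: "dfun f \<Longrightarrow> dfun (\<lambda>v. fact (f v))"
  unfolding fact_eq_div by (intro dioph_intros dfun_power dfun_div dfun_choose)

section \<open>Bounded universal quantification\<close>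

lemma peval_eq_on:
  "(\<And>x. x \<in> set_pexp p \<Longrightarrow> e x = e' x) \<Longrightarrow> peval p e = peval p e'"
  by (induction p) auto

lemma peval_mono:
  fixes e e' :: "'v \<Rightarrow> nat"
  shows "(\<And>x. e x \<le> e' x) \<Longrightarrow> peval p e \<le> peval p e'"
  by (induction p) (auto intro: add_mono mult_le_mono)

lemma peval_cong_mod:
  fixes e e' :: "'v \<Rightarrow> nat"
  shows "(\<And>x. x \<in> set_pexp p \<Longrightarrow> [e x = e' x] (mod m)) \<Longrightarrow> [peval p e = peval p e'] (mod m)"
  by (induction p) (auto intro: cong_add cong_mult)

lemma dfun_peval: "(\<And>x. dfun (f x)) \<Longrightarrow> dfun (\<lambda>v. peval p (\<lambda>x. f x v))"
  by (induction p) (auto intro: dioph_intros)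

lemma fact_mult_choose: "fact j * (a choose j) = (\<Prod>i<j. a - i)"
  by (induction j) (simp, simp only: fact_choose_Suc prod.lessThan_Suc mult.commute)

text \<open>The coefficient is the product of the fractions \<open>(r + k + 1) / (k + 1)\<close>,
  each an integer when \<open>Suc k\<close> divides \<open>r\<close>.\<close>

lemma choose_eq_prod:
  assumes "\<And>k. k < y \<Longrightarrow> Suc k dvd r"
  shows "(r + y) choose y = (\<Prod>k<y. 1 + r div Suc k)"
  using assms
proof (induction y)
  case (Suc y)
  have "Suc y * ((r + Suc y) choose Suc y) = Suc (r + y) * ((r + y) choose y)"
    using Suc_times_binomial[of y "r + y"] by simp
  also have "Suc (r + y) = Suc y * (1 + r div Suc y)"
    using Suc.prems[of y] by (metis add_Suc_right add.commute dvd_mult_div_cancel lessI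
      mult.right_neutral distrib_left)
  finally have "(r + Suc y) choose Suc y = (1 + r div Suc y) * ((r + y) choose y)"
    by (metis mult.assoc mult_left_cancel nat.distinct(1))
  then show ?case using Suc by simp
qed simp

lemma not_coprime_prime:
  fixes a b :: nat
  assumes "\<not> coprime a b"
  shows "\<exists>p. prime p \<and> p dvd a \<and> p dvd b"
proof -
  obtain p where "prime p" "p dvd gcd a b"
    using assms prime_factor_nat[of "gcd a b"] by (auto simp: coprime_iff_gcd_eq_1)
  then show ?thesis by auto
qed

text \<open>
  The numbers \<open>1 + (Q!)\<^sup>2 / (k + 1)\<close> serve as moduli for the Chinese remainder theorem.  Their
  product is a binomial coefficient, and \<open>- (Q!)\<^sup>2 - 1\<close> is congruent to \<open>k\<close> modulo the \<open>k\<close>-th one.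
\<close>

definition crt_mod :: "nat \<Rightarrow> nat \<Rightarrow> nat" where
  "crt_mod Q k = 1 + (fact Q)\<^sup>2 div Suc k"

lemma Suc_dvd_fact_sq: "k < Q \<Longrightarrow> Suc k dvd (fact Q)\<^sup>2"
  by (simp add: dvd_fact power2_eq_square)

lemma dvd_add_imp_cong:
  fixes a b c m :: nat
  assumes "m dvd a + c" "m dvd b + c"
  shows "[a = b] (mod m)"
proof -
  have "[a + c = b + c] (mod m)" using assms by (metis cong_0_iff cong_sym cong_trans)
  then show ?thesis by (simp add: cong_add_rcancel_nat)
qed

lemma crt_mod_mult:
  assumes "k < Q"
  shows "k + (fact Q)\<^sup>2 + 1 = Suc k * crt_mod Q k"
  using dvd_mult_div_cancel[OF Suc_dvd_fact_sq[OF assms]] by (simp add: crt_mod_def)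

text \<open>A prime up to \<open>Q\<close> divides \<open>fact Q\<close>, hence the modulus minus
  1.\<close>

lemma prime_dvd_crt_mod:
  assumes "prime p" "p dvd crt_mod Q k" "k < Q"
  shows "Q < p"
proof (rule ccontr)
  assume "\<not> Q < p"
  then have "p dvd fact Q" using assms(1) by (simp add: prime_dvd_fact_iff)
  then have "p dvd fact Q * (fact Q div Suc k)" by simp
  also have "fact Q * (fact Q div Suc k) = (fact Q)\<^sup>2 div Suc k"
    using assms(3) by (simp add: div_mult_swap dvd_fact power2_eq_square)
  finally have "p dvd 1" using assms(2) unfolding crt_mod_def by (metis dvd_add_left_iff)
  then show False using assms(1) by simp
qed

text \<open>A common prime \<open>p\<close> makes \<open>j\<close> and \<open>k\<close> congruent,
  since both are \<open>- (fact Q)^2 - 1\<close> modulo \<open>p\<close>; but they are smaller than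
  \<open>p\<close>.\<close>

lemma coprime_crt_mod:
  assumes "j < Q" "k < Q" "j \<noteq> k"
  shows "coprime (crt_mod Q j) (crt_mod Q k)"
proof (rule ccontr)
  assume "\<not> ?thesis"
  then obtain p where p: "prime p" "p dvd crt_mod Q j" "p dvd crt_mod Q k"
    using not_coprime_prime by blast
  have "p dvd j + ((fact Q)\<^sup>2 + 1)" "p dvd k + ((fact Q)\<^sup>2 + 1)"
    using p crt_mod_mult[OF assms(1)] crt_mod_mult[OF assms(2)] by (simp_all only: add.assoc dvd_mult)
  then have "[j = k] (mod p)"
    by (rule dvd_add_imp_cong)
  moreover have "j < p" "k < p" using prime_dvd_crt_mod p assms by (meson less_trans)+
  ultimately show False using assms(3) cong_less_modulus_unique_nat by blast
qed

lemma crt_mod_coprime_fact: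
  assumes "j \<le> Q" "k < Q"
  shows "coprime (crt_mod Q k) (fact j)"
proof (rule ccontr)
  assume "\<not> ?thesis"
  then obtain p where p: "prime p" "p dvd crt_mod Q k" "p dvd fact j"
    using not_coprime_prime by blast
  then show False using prime_dvd_crt_mod[OF p(1,2) assms(2)] assms(1) by (simp add: prime_dvd_fact_iff)
qed

lemma choose_eq_prod_crt_mod:
  assumes "y \<le> Q"
  shows "((fact Q)\<^sup>2 + y) choose y = (\<Prod>k<y. crt_mod Q k)"
  unfolding crt_mod_def using assms by (intro choose_eq_prod Suc_dvd_fact_sq) simp

text \<open>The prime divides some factor of \<open>a * (a - 1) * ... * (a - u)\<close>. Together
  with \<open>crt_mod_dvd_choose\<close> this expresses a bound on residues by a
  divisibility.\<close>

lemma prime_dvd_choose_imp: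
  fixes p :: nat
  assumes "prime p" "p dvd a choose Suc u"
  shows "\<exists>w\<le>u. [a = w] (mod p)"
proof (cases "a \<le> u")
  case False
  have "p dvd (\<Prod>i<Suc u. a - i)"
    using assms(2) unfolding fact_mult_choose[symmetric] by simp
  then have "\<exists>j\<in>{..<Suc u}. p dvd a - j"
    using assms(1) by (simp only: prime_dvd_prod_iff finite_lessThan)
  then obtain j where j: "j < Suc u" "p dvd a - j" by blast
  then have "[a = j] (mod p)" using False by (metis cong_altdef_nat le_trans less_Suc_eq_le nat_le_linear)
  then show ?thesis using j by (intro exI[of _ j]) auto
qed auto

lemma crt_mod_dvd_choose:
  assumes "w \<le> u" "[a = w] (mod crt_mod Q k)" "u < Q" "k < Q"
  shows "crt_mod Q k dvd a choose Suc u"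
proof (cases "a \<le> u")
  case False
  have "crt_mod Q k dvd a - w"
    using assms(1,2) False by (simp add: cong_altdef_nat)
  also have "a - w dvd (\<Prod>i<Suc u. a - i)" using assms(1) by (intro dvd_prodI) auto
  finally have "crt_mod Q k dvd fact (Suc u) * (a choose Suc u)" by (simp only: fact_mult_choose)
  moreover have "coprime (crt_mod Q k) (fact (Suc u))" using assms by (intro crt_mod_coprime_fact) auto
  ultimately show ?thesis by (simp only: coprime_dvd_mult_right_iff)
qed (simp add: binomial_eq_0)

text \<open>All \<open>y\<close> witnesses are packed into one solution modulo the product of the
  moduli: \<open>c\<close> is congruent to \<open>k\<close> modulo the \<open>k\<close>-th one, and
  \<open>a i\<close> collects the \<open>i\<close>-th coordinates. Divisibility of
  \<open>a i choose Suc u\<close> keeps these at most \<open>u\<close> modulo a prime factor. As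
  \<open>Q\<close> exceeds both sides for arguments bounded by \<open>y\<close> and
  \<open>u\<close>, their congruence modulo a prime above \<open>Q\<close> is an equality.\<close>

lemma bounded_forall_iff:
  fixes P P' :: "nat \<Rightarrow> (nat \<Rightarrow> nat) \<Rightarrow> nat"
  assumes mono: "\<And>k k' w w'. k \<le> k' \<Longrightarrow> (\<And>i. w i \<le> w' i) \<Longrightarrow> P k w \<le> P k' w' \<and> P' k w \<le> P' k' w'"
    and cong: "\<And>k k' w w' m. [k = k'] (mod m) \<Longrightarrow> (\<And>i. i < N \<Longrightarrow> [w i = w' i] (mod m)) \<Longrightarrow>
      [P k w = P k' w'] (mod m) \<and> [P' k w = P' k' w'] (mod m)"
  shows "(\<forall>k<y. \<exists>w. P k w = P' k w) \<longleftrightarrow>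
    (\<exists>u Q c a. Q = P y (\<lambda>_. u) + P' y (\<lambda>_. u) + u + y + 1 \<and>
      ((fact Q)\<^sup>2 + y) choose y dvd c + (fact Q)\<^sup>2 + 1 \<and>
      (\<forall>i<N. ((fact Q)\<^sup>2 + y) choose y dvd a i choose Suc u) \<and>
      [P c a = P' c a] (mod (((fact Q)\<^sup>2 + y) choose y)))"
    (is "?L \<longleftrightarrow> ?R")
proof
  assume ?L
  then obtain w where w: "\<And>k. k < y \<Longrightarrow> P k (w k) = P' k (w k)" by metis
  define u where "u = (\<Sum>k<y. \<Sum>i<N. w k i)"
  define Q where "Q = P y (\<lambda>_. u) + P' y (\<lambda>_. u) + u + y + 1"
  define W where "W = ((fact Q)\<^sup>2 + y) choose y"
  have W: "W = (\<Prod>k<y. crt_mod Q k)"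
    unfolding W_def by (rule choose_eq_prod_crt_mod) (simp add: Q_def)
  have yQ: "k < Q" if "k < y" for k using that by (simp add: Q_def)
  have cop: "coprime (crt_mod Q j) (crt_mod Q k)" if "j < y" "k < y" "j \<noteq> k" for j k
    using that yQ by (intro coprime_crt_mod)
  have wu: "w k i \<le> u" if "k < y" "i < N" for k i
  proof -
    have "w k i \<le> (\<Sum>i<N. w k i)" using that by (intro member_le_sum) auto
    also have "\<dots> \<le> u" unfolding u_def using that by (intro member_le_sum[of k _ "\<lambda>k. \<Sum>i<N. w k i"]) auto
    finally show ?thesis .
  qed
  have "\<exists>x. \<forall>k\<in>{..<y}. [x = w k i] (mod crt_mod Q k)" for i
    using cop by (intro chinese_remainder_nat) auto
  then obtain a where a: "\<And>k i. k < y \<Longrightarrow> [a i = w k i] (mod crt_mod Q k)" by (metis lessThan_iff)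
  have glue: "[x = z] (mod W)" if "\<And>k. k < y \<Longrightarrow> [x = z] (mod crt_mod Q k)" for x z
    unfolding W using that cop by (intro coprime_cong_prod_nat) auto
  have "W \<noteq> 0" by (simp add: W_def)
  \<comment> \<open>This \<open>c\<close> is \<open>- (fact Q)^2 - 1\<close> shifted by a multiple
    of \<open>W\<close> into the natural numbers.\<close>
  then obtain c where c: "c + ((fact Q)\<^sup>2 + 1) = W * ((fact Q)\<^sup>2 + 1)"
    by (metis add.commute le_Suc_ex mult_le_mono1 nat_mult_1 Suc_leI not_gr_zero One_nat_def)
  have ck: "[c = k] (mod crt_mod Q k)" if "k < y" for k
  proof -
    have "crt_mod Q k dvd W" unfolding W using that by (intro dvd_prodI) auto
    then have "crt_mod Q k dvd c + ((fact Q)\<^sup>2 + 1)" unfolding c by simp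
    moreover have "crt_mod Q k dvd k + ((fact Q)\<^sup>2 + 1)"
      using crt_mod_mult[OF yQ[OF that]] by (simp only: add.assoc dvd_triv_right)
    ultimately show ?thesis by (rule dvd_add_imp_cong)
  qed
  have "[P c a = P' c a] (mod W)"
  proof (rule glue)
    fix k assume k: "k < y"
    have "[P c a = P k (w k)] (mod crt_mod Q k)" "[P' k (w k) = P' c a] (mod crt_mod Q k)"
      using cong[where k = c and k' = k and w = a and w' = "w k" and m = "crt_mod Q k"] ck[OF k] a[OF k]
      by (simp_all add: cong_sym)
    then show "[P c a = P' c a] (mod crt_mod Q k)" using w[OF k] cong_trans by metis
  qed
  moreover have "W dvd a i choose Suc u" if "i < N" for i
  proof -
    have "[a i choose Suc u = 0] (mod W)"
    proof (rule glue)
      fix k assume k: "k < y"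
      show "[a i choose Suc u = 0] (mod crt_mod Q k)"
        unfolding cong_0_iff
        by (rule crt_mod_dvd_choose[OF wu[OF k that] a[OF k] _ yQ[OF k]]) (simp add: Q_def)
    qed
    then show ?thesis by (simp add: cong_0_iff)
  qed
  moreover have "W dvd c + (fact Q)\<^sup>2 + 1" using c by (simp add: add.assoc)
  ultimately show ?R unfolding W_def Q_def by blast
next
  assume ?R
  then obtain u Q c a where Q: "Q = P y (\<lambda>_. u) + P' y (\<lambda>_. u) + u + y + 1"
    and c: "((fact Q)\<^sup>2 + y) choose y dvd c + (fact Q)\<^sup>2 + 1"
    and a: "\<And>i. i < N \<Longrightarrow> ((fact Q)\<^sup>2 + y) choose y dvd a i choose Suc u"
    and P: "[P c a = P' c a] (mod (((fact Q)\<^sup>2 + y) choose y))" by blast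
  have W: "((fact Q)\<^sup>2 + y) choose y = (\<Prod>k<y. crt_mod Q k)"
    by (rule choose_eq_prod_crt_mod) (simp add: Q)
  show ?L
  proof (intro allI impI)
    fix k assume k: "k < y"
    have kQ: "k < Q" using k by (simp add: Q)
    have "Suc k \<le> (fact Q)\<^sup>2" using Suc_dvd_fact_sq[OF kQ] by (intro dvd_imp_le) auto
    then have "crt_mod Q k \<noteq> 1" by (simp add: crt_mod_def div_eq_0_iff)
    \<comment> \<open>A prime factor is taken because divisibility of the falling factorial passes
      to a single factor only modulo a prime.\<close>
    then obtain r where r: "prime r" "r dvd crt_mod Q k" using prime_factor_nat by blast
    have "crt_mod Q k dvd (\<Prod>k<y. crt_mod Q k)" using k by (intro dvd_prodI) auto
    then have rW: "r dvd ((fact Q)\<^sup>2 + y) choose y" using r(2) W dvd_trans by metis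
    have rQ: "Q < r" using prime_dvd_crt_mod r kQ by blast
    \<comment> \<open>Coordinates from \<open>N\<close> on carry no congruence, but monotonicity
      needs the bound \<open>u\<close> for them too.\<close>
    have "\<exists>w. w \<le> u \<and> (i < N \<longrightarrow> [a i = w] (mod r))" for i
      using prime_dvd_choose_imp[OF r(1), of "a i" u] a[of i] rW by (cases "i < N") (auto dest: dvd_trans)
    then obtain w where w: "\<And>i. w i \<le> u" "\<And>i. i < N \<Longrightarrow> [a i = w i] (mod r)" by metis
    have "r dvd c + ((fact Q)\<^sup>2 + 1)" using c rW by (metis add.assoc dvd_trans)
    moreover have "r dvd k + ((fact Q)\<^sup>2 + 1)"
      using crt_mod_mult[OF kQ] r(2) by (simp only: add.assoc dvd_mult)
    ultimately have ck: "[c = k] (mod r)" by (rule dvd_add_imp_cong)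
    have "[P c a = P k w] (mod r)" "[P' c a = P' k w] (mod r)"
      using cong[where k = c and k' = k and w = a and w' = w and m = r] ck w(2) by simp_all
    moreover have "[P c a = P' c a] (mod r)" using P rW by (rule cong_dvd_modulus_nat)
    ultimately have "[P k w = P' k w] (mod r)" by (meson cong_sym cong_trans)
    moreover have "P k w \<le> P y (\<lambda>_. u)" "P' k w \<le> P' y (\<lambda>_. u)"
      using mono[where k = k and k' = y and w = w and w' = "\<lambda>_. u"] k w(1) by simp_all
    then have "P k w < r" "P' k w < r" using rQ Q by linarith+
    ultimately have "P k w = P' k w" using cong_less_modulus_unique_nat by blast
    then show "\<exists>w. P k w = P' k w" by blast
  qed
qed

text \<open>Polynomial expressions over natural numbers are monotone and respect congruences, as
  \<open>bounded_forall_iff\<close> asks; \<open>N\<close> bounds the indices of the unknowns that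
  occur in them.\<close>

lemma dioph_bounded_forall:
  assumes "dioph (\<lambda>v. R (\<lambda>i. v (Suc i)) (v 0))" "dfun b"
  shows "dioph (\<lambda>v. \<forall>k<b v. R v k)"
proof -
  obtain p q :: "(nat + nat) pexp" where
    pq: "\<And>v. R (\<lambda>i. v (Suc i)) (v 0) \<longleftrightarrow>
      (\<exists>w. peval p (case_sum v w) = peval q (case_sum v w))"
    using assms(1) by (rule diophE) blast
  have R: "R v k \<longleftrightarrow> (\<exists>w. peval p (case_sum (case_nat k v) w) = peval q (case_sum (case_nat k v) w))"
    for v k
    using pq[of "case_nat k v"] by simp
  have "finite (set_pexp r)" for r :: "(nat + nat) pexp" by (induction r) auto
  then have "finite (Inr -` (set_pexp p \<union> set_pexp q))"
    by (intro finite_vimageI) (auto simp: inj_def)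
  then obtain N where N: "\<And>i. Inr i \<in> set_pexp p \<union> set_pexp q \<Longrightarrow> i < N"
    unfolding finite_nat_set_iff_bounded by blast
  have ev: "dfun (\<lambda>v. peval r (case_sum (case_nat (f v) (\<lambda>i. g i v)) (\<lambda>i. h i v)))"
    if "dfun f" "\<And>i. dfun (g i)" "\<And>i. dfun (h i)" for r :: "(nat + nat) pexp" and f g h
  proof -
    have "dfun (\<lambda>v. case_sum (case_nat (f v) (\<lambda>i. g i v)) (\<lambda>i. h i v) x)" for x
    proof (cases x)
      case (Inl i)
      then show ?thesis using that by (cases i) simp_all
    qed (use that in simp)
    then show ?thesis by (rule dfun_peval)
  qed
  let ?e = "\<lambda>r k v w. peval r (case_sum (case_nat k v) w)"
  have "(\<forall>k<y. R v k) \<longleftrightarrow>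
    (\<exists>u Q c a. Q = ?e p y v (\<lambda>_. u) + ?e q y v (\<lambda>_. u) + u + y + 1 \<and>
      ((fact Q)\<^sup>2 + y) choose y dvd c + (fact Q)\<^sup>2 + 1 \<and>
      (\<forall>i<N. ((fact Q)\<^sup>2 + y) choose y dvd a i choose Suc u) \<and>
      [?e p c v a = ?e q c v a] (mod (((fact Q)\<^sup>2 + y) choose y)))" for y v
    unfolding R
  proof (rule bounded_forall_iff)
    show "?e p k v w \<le> ?e p k' v w' \<and> ?e q k v w \<le> ?e q k' v w'"
      if "k \<le> k'" "\<And>i. w i \<le> w' i" for k k' w w'
      using that by (auto intro!: peval_mono split: sum.split nat.split)
    show "[?e p k v w = ?e p k' v w'] (mod m) \<and> [?e q k v w = ?e q k' v w'] (mod m)"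
      if "[k = k'] (mod m)" "\<And>i. i < N \<Longrightarrow> [w i = w' i] (mod m)" for k k' w w' m
      using that N by (auto intro!: peval_cong_mod split: sum.split nat.split)
  qed
  then show ?thesis
    unfolding power2_eq_square
    by (simp only:) (rule dioph_ex dioph_ex_seq dioph_conj dioph_eq dioph_dvd dioph_cong
      dioph_ball_lessThan ev dfun_add dfun_mult dfun_choose dfun_fact dfun_Suc dfun_const dfun_var
      dfun_rename[OF assms(2)])+
qed

section \<open>Graphs of recursive functions\<close>

text \<open>A finite sequence becomes two numbers, a base and a digit expansion, so quantifying over
  sequences of variable length takes two unknowns.\<close>

lemma exists_digits:
  fixes s :: "nat \<Rightarrow> nat"
  shows "\<exists>B S. \<forall>i\<le>n. (S div B ^ i) mod B = s i"
proof -
  define B where "B = Suc (\<Sum>j<Suc n. s j)"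
  have "s j < B" if "j < Suc n" for j
    unfolding B_def less_Suc_eq_le using that by (intro member_le_sum) auto
  then have "((\<Sum>j<Suc n. s j * B ^ j) div B ^ i) mod B = (if i < Suc n then s i else 0)" for i
    by (rule digit_sum)
  then show ?thesis by (metis le_imp_less_Suc)
qed

lemma computes_Zero_iff: "computes ZeroF xs z \<longleftrightarrow> z = 0"
  by (auto elim: computes_ZeroE intro: computes.intros)

lemma computes_Succ_iff: "computes SuccF xs z \<longleftrightarrow> (\<exists>x. xs = [x] \<and> z = Suc x)"
  by (auto elim: computes_SuccE intro: computes.intros)

lemma computes_Proj_iff: "computes (Proj i) xs z \<longleftrightarrow> i < length xs \<and> z = xs ! i"
  by (auto elim: computes_ProjE intro: computes.intros)

lemma computes_Comp_iff:
  "computes (Comp f gs) xs z \<longleftrightarrow> (\<exists>y :: nat \<Rightarrow> nat.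
    (\<forall>j<length gs. computes (gs ! j) xs (y j)) \<and> computes f (map y [0..<length gs]) z)"
proof
  assume "computes (Comp f gs) xs z"
  then obtain ys where ys: "list_all2 (\<lambda>g y. computes g xs y) gs ys" "computes f ys z"
    by (rule computes_CompE)
  then have "map ((!) ys) [0..<length gs] = ys"
    by (simp add: list_all2_lengthD map_nth)
  then show "\<exists>y. (\<forall>j<length gs. computes (gs ! j) xs (y j)) \<and> computes f (map y [0..<length gs]) z"
    using ys by (intro exI[of _ "(!) ys"]) (simp add: list_all2_conv_all_nth)
next
  assume "\<exists>y. (\<forall>j<length gs. computes (gs ! j) xs (y j)) \<and> computes f (map y [0..<length gs]) z"
  then show "computes (Comp f gs) xs z"
    by (auto intro!: computes.intros(4) simp: list_all2_conv_all_nth)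
qed

text \<open>The sequence \<open>s\<close> is the history of the recursion; this turns the recursion
  into a bounded universal statement.\<close>

lemma computes_PrimRec_iff_seq:
  "computes (PrimRec f g) (n # xs) z \<longleftrightarrow> (\<exists>s :: nat \<Rightarrow> nat.
    computes f xs (s 0) \<and> (\<forall>i<n. computes g (i # s i # xs) (s (Suc i))) \<and> s n = z)"
proof
  assume "computes (PrimRec f g) (n # xs) z"
  then show "\<exists>s. computes f xs (s 0) \<and> (\<forall>i<n. computes g (i # s i # xs) (s (Suc i))) \<and> s n = z"
  proof (induction n arbitrary: z)
    case 0
    then show ?case by (auto elim: computes_PrimRec0E intro: exI[of _ "\<lambda>_. z"])
  next
    case (Suc n)
    from Suc.prems obtain y where y: "computes (PrimRec f g) (n # xs) y" "computes g (n # y # xs) z"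
      by (rule computes_PrimRecSucE)
    then obtain s where "computes f xs (s 0)" "\<forall>i<n. computes g (i # s i # xs) (s (Suc i))" "s n = y"
      using Suc.IH by blast
    then show ?case using y by (intro exI[of _ "s(Suc n := z)"]) (simp add: less_Suc_eq)
  qed
next
  assume "\<exists>s. computes f xs (s 0) \<and> (\<forall>i<n. computes g (i # s i # xs) (s (Suc i))) \<and> s n = z"
  then obtain s where s: "computes f xs (s 0)" "\<forall>i<n. computes g (i # s i # xs) (s (Suc i))" "s n = z"
    by blast
  have "computes (PrimRec f g) (i # xs) (s i)" if "i \<le> n" for i
    using that
  proof (induction i)
    case (Suc i)
    then show ?case using s(2) by (intro computes.intros(6)[of f g i xs "s i"]) auto
  qed (simp add: s(1) computes.intros)
  then show "computes (PrimRec f g) (n # xs) z" using s(3) by blast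
qed

lemma computes_PrimRec_iff:
  "computes (PrimRec f g) (n # xs) z \<longleftrightarrow> (\<exists>B S. computes f xs ((S div B ^ 0) mod B) \<and>
    (\<forall>i<n. computes g (i # (S div B ^ i) mod B # xs) ((S div B ^ Suc i) mod B)) \<and>
    (S div B ^ n) mod B = z)"
    (is "_ \<longleftrightarrow> ?R")
proof
  assume "computes (PrimRec f g) (n # xs) z"
  then obtain s where s: "computes f xs (s 0)" "\<forall>i<n. computes g (i # s i # xs) (s (Suc i))" "s n = z"
    unfolding computes_PrimRec_iff_seq by blast
  obtain B S where BS: "\<forall>i\<le>n. (S div B ^ i) mod B = s i" using exists_digits by blast
  \<comment> \<open>The deleted simplification rules would rewrite the digits at places
    \<open>0\<close> and \<open>Suc i\<close> so that \<open>BS\<close> no longer matches.\<close>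
  show ?R
    using s BS by (intro exI[of _ B] exI[of _ S]) (simp del: power_Suc power_0 div_by_1)
next
  assume ?R
  then obtain B S where "computes f xs ((S div B ^ 0) mod B)"
    "\<forall>i<n. computes g (i # (S div B ^ i) mod B # xs) ((S div B ^ Suc i) mod B)"
    "(S div B ^ n) mod B = z" by blast
  then show "computes (PrimRec f g) (n # xs) z"
    unfolding computes_PrimRec_iff_seq by (intro exI[of _ "\<lambda>i. (S div B ^ i) mod B"]) blast
qed

lemma computes_Mu_iff:
  "computes (Mu f) xs n \<longleftrightarrow> computes f (n # xs) 0 \<and> (\<forall>k<n. \<exists>y. computes f (k # xs) (Suc y))"
  by (auto elim: computes_MuE intro: computes.intros)

lemma computes_PrimRec_Nil: "\<not> computes (PrimRec f g) [] z"
  by (auto elim: computes.cases)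

lemma dfun_rename_list:
  "\<forall>h\<in>set hs. dfun h \<Longrightarrow> \<forall>h\<in>set (map (\<lambda>h v. h (\<lambda>i. v (\<rho> i))) hs). dfun h"
  by (auto intro: dfun_rename)

text \<open>Allowing Diophantine functions as arguments builds substitution into the induction, so
  that values computed by one subterm can be passed to another.\<close>

lemma dioph_computes:
  assumes "\<forall>h\<in>set hs. dfun h" "dfun r"
  shows "dioph (\<lambda>v. computes f (map (\<lambda>h. h v) hs) (r v))"
  using assms
proof (induction f arbitrary: hs r)
  case ZeroF
  then show ?case unfolding computes_Zero_iff by (intro dioph_eq dfun_const) auto
next
  case SuccF
  show ?case
  proof (cases "\<exists>h. hs = [h]")
    case True
    then obtain h where "hs = [h]" by blast
    then show ?thesis using SuccF by (simp add: computes_Succ_iff dioph_eq dfun_Suc)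
  next
    case False
    then have "\<not> computes SuccF (map (\<lambda>h. h v) hs) (r v)" for v
      by (auto simp: computes_Succ_iff map_eq_Cons_conv)
    then show ?thesis by (simp add: dioph_False)
  qed
next
  case (Proj i)
  then show ?case
    by (cases "i < length hs") (auto simp: computes_Proj_iff dioph_False intro!: dioph_eq)
next
  case (Comp f gs)
  let ?hs = "map (\<lambda>h v. h (\<lambda>i. v (2 * i))) hs"
  have hs: "\<forall>h\<in>set ?hs. dfun h" using Comp.prems(1) by (rule dfun_rename_list)
  have "dioph (\<lambda>v. computes (gs ! j) (map (\<lambda>h. h (\<lambda>i. v (2 * i))) hs) (v (Suc (2 * j))))"
    if "j < length gs" for j
    using Comp.IH(2)[OF nth_mem[OF that] hs dfun_var[of "Suc (2 * j)"]] by (simp add: comp_def)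
  moreover have "dioph (\<lambda>v. computes f (map (\<lambda>i. v (Suc (2 * i))) [0..<length gs]) (r (\<lambda>i. v (2 * i))))"
    using Comp.IH(1)[of "map (\<lambda>i v. v (Suc (2 * i))) [0..<length gs]" "\<lambda>v. r (\<lambda>i. v (2 * i))"]
      dfun_rename[OF Comp.prems(2)] dfun_var
    by (auto simp: comp_def)
  ultimately show ?case
    unfolding computes_Comp_iff by (intro dioph_ex_seq dioph_conj dioph_ball_lessThan)
next
  case (PrimRec f g)
  show ?case
  proof (cases hs)
    case Nil
    then show ?thesis by (simp add: computes_PrimRec_Nil dioph_False)
  next
    case (Cons b hs')
    have b: "dfun b" and hs': "\<forall>h\<in>set hs'. dfun h" using PrimRec.prems(1) Cons by auto
    \<comment> \<open>Place 0 holds the digit expansion \<open>S\<close>, place 1 the base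
      \<open>B\<close>; under the bounded quantifier both move up by one.\<close>
    have 1: "dioph (\<lambda>v. computes f (map (\<lambda>h. h (\<lambda>i. v (Suc (Suc i)))) hs')
        ((v 0 div v (Suc 0) ^ 0) mod v (Suc 0)))"
      using PrimRec.IH(1)[OF dfun_rename_list[OF hs', of "\<lambda>i. Suc (Suc i)"],
          of "\<lambda>v. (v 0 div v (Suc 0) ^ 0) mod v (Suc 0)"]
      by (simp add: comp_def dfun_mod dfun_div dfun_power dfun_var dfun_const)
    have 2: "dioph (\<lambda>v. computes g (v 0 # (v 1 div v 2 ^ v 0) mod v 2 #
        map (\<lambda>h. h (\<lambda>i. v (Suc (Suc (Suc i))))) hs') ((v 1 div v 2 ^ Suc (v 0)) mod v 2))"
      using PrimRec.IH(2)[of "(\<lambda>v. v 0) # (\<lambda>v. (v 1 div v 2 ^ v 0) mod v 2) #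
            map (\<lambda>h v. h (\<lambda>i. v (Suc (Suc (Suc i))))) hs'"
          "\<lambda>v. (v 1 div v 2 ^ Suc (v 0)) mod v 2"]
        dfun_rename_list[OF hs', of "\<lambda>i. Suc (Suc (Suc i))"]
      by (simp add: comp_def dfun_mod dfun_div dfun_power dfun_var dfun_Suc del: power_Suc)
    have "dioph (\<lambda>v. \<forall>i<b (\<lambda>i. v (Suc (Suc i))).
        computes g (i # (v 0 div v (Suc 0) ^ i) mod v (Suc 0) #
          map (\<lambda>h. h (\<lambda>i. v (Suc (Suc i)))) hs') ((v 0 div v (Suc 0) ^ Suc i) mod v (Suc 0)))"
      by (rule dioph_bounded_forall) (use 2 dfun_rename[OF b] in \<open>simp_all add: numeral_2_eq_2\<close>)
    moreover have "dioph (\<lambda>v. (v 0 div v (Suc 0) ^ b (\<lambda>i. v (Suc (Suc i)))) mod v (Suc 0) =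
        r (\<lambda>i. v (Suc (Suc i))))"
      by (intro dioph_eq dfun_mod dfun_div dfun_power dfun_var dfun_rename[OF b]
        dfun_rename[OF PrimRec.prems(2)])
    ultimately show ?thesis
      unfolding Cons list.map computes_PrimRec_iff using 1 by (intro dioph_ex dioph_conj)
  qed
next
  case (Mu f)
  have "dioph (\<lambda>v. computes f (r v # map (\<lambda>h. h v) hs) 0)"
    using Mu.IH[of "r # hs" "\<lambda>v. 0"] Mu.prems by (simp add: dfun_const)
  moreover have "dioph (\<lambda>v. computes f (v (Suc 0) # map (\<lambda>h. h (\<lambda>i. v (Suc (Suc i)))) hs) (Suc (v 0)))"
    using Mu.IH[of "(\<lambda>v. v (Suc 0)) # map (\<lambda>h v. h (\<lambda>i. v (Suc (Suc i)))) hs" "\<lambda>v. Suc (v 0)"]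
      dfun_rename_list[OF Mu.prems(1), of "\<lambda>i. Suc (Suc i)"]
    by (simp add: comp_def dfun_Suc dfun_var)
  ultimately show ?case
    unfolding computes_Mu_iff
    by (intro dioph_conj dioph_bounded_forall dioph_ex Mu.prems(2))
qed

section \<open>Profile polynomials and their encoding\<close>

lemma finite_set_pexp: "finite (set_pexp p)"
  by (induction p) auto

lemma poly_value_add: "poly_value (p + q) xs = poly_value p xs + poly_value q xs"
  unfolding poly_value_def
  by (rule setsum_keys_plus_distrib) (simp_all add: distrib_right)

lemma poly_value_zero: "poly_value 0 xs = 0"
  by (simp add: poly_value_def)

lemma poly_value_sum: "poly_value (\<Sum>i\<in>A. f i) xs = (\<Sum>i\<in>A. poly_value (f i) xs)"
  by (induction A rule: infinite_finite_induct) (simp_all add: poly_value_zero poly_value_add)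

lemma poly_value_single:
  "poly_value (Poly_Mapping.single e c) xs = c * (\<Prod>i<length xs. xs ! i ^ Poly_Mapping.lookup e i)"
  by (simp add: poly_value_def)

lemma poly_value_of_nat: "poly_value (of_nat n) xs = of_nat n"
  unfolding single_of_nat[symmetric] poly_value_single by simp

lemma poly_mapping_eq_sum_single:
  "p = (\<Sum>e\<in>Poly_Mapping.keys p. Poly_Mapping.single e (Poly_Mapping.lookup p e))"
  by (rule poly_mapping_eqI)
    (simp add: Poly_Mapping.lookup_sum lookup_single when_def sum.delta in_keys_iff)

text \<open>Expanding both factors into monomials reduces this to single monomials, whose exponents
  add.\<close>

lemma poly_value_mult: "poly_value (p * q) xs = poly_value p xs * poly_value q xs"
proof -
  have single: "poly_value (Poly_Mapping.single e c * Poly_Mapping.single e' c') xs =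
      poly_value (Poly_Mapping.single e c) xs * poly_value (Poly_Mapping.single e' c') xs" for e e' c c'
    by (simp add: mult_single poly_value_single lookup_add power_add prod.distrib mult_ac)
  have "poly_value (p * q) xs = poly_value
      ((\<Sum>e\<in>Poly_Mapping.keys p. Poly_Mapping.single e (Poly_Mapping.lookup p e)) *
        (\<Sum>e\<in>Poly_Mapping.keys q. Poly_Mapping.single e (Poly_Mapping.lookup q e))) xs"
    by (simp flip: poly_mapping_eq_sum_single)
  also have "\<dots> = poly_value (\<Sum>e\<in>Poly_Mapping.keys p. Poly_Mapping.single e (Poly_Mapping.lookup p e)) xs *
      poly_value (\<Sum>e\<in>Poly_Mapping.keys q. Poly_Mapping.single e (Poly_Mapping.lookup q e)) xs"
    by (simp add: sum_product poly_value_sum single)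
  also have "\<dots> = poly_value p xs * poly_value q xs"
    by (simp flip: poly_mapping_eq_sum_single)
  finally show ?thesis .
qed

primrec to_poly :: "nat pexp \<Rightarrow> profile_poly" where
  "to_poly (Var i) = Poly_Mapping.single (Poly_Mapping.single i 1) 1"
| "to_poly (Const n) = of_nat n"
| "to_poly (Add p q) = to_poly p + to_poly q"
| "to_poly (Mul p q) = to_poly p * to_poly q"

lemma poly_value_to_poly:
  assumes "set_pexp p \<subseteq> {..<length xs}"
  shows "poly_value (to_poly p) xs = peval p ((!) xs)"
  using assms
proof (induction p)
  case (Var i)
  have "(\<Prod>j<length xs. xs ! j ^ Poly_Mapping.lookup (Poly_Mapping.single i 1) j) =
      (\<Prod>j<length xs. if j = i then xs ! j else 1)"
    by (intro prod.cong) (auto simp: lookup_single when_def)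
  then show ?case using Var by (simp add: poly_value_single)
qed (simp_all add: poly_value_of_nat poly_value_add poly_value_mult)

lemma polys_in_add: "p \<in> polys_in m \<Longrightarrow> q \<in> polys_in m \<Longrightarrow> p + q \<in> polys_in m"
  using keys_add[of p q] by (auto simp: polys_in_def)

lemma polys_in_mult: "p \<in> polys_in m \<Longrightarrow> q \<in> polys_in m \<Longrightarrow> p * q \<in> polys_in m"
proof -
  assume *: "p \<in> polys_in m" "q \<in> polys_in m"
  have "Poly_Mapping.keys e \<subseteq> {..<m}" if e: "e \<in> Poly_Mapping.keys (p * q)" for e
  proof -
    obtain a b where "e = a + b" "a \<in> Poly_Mapping.keys p" "b \<in> Poly_Mapping.keys q"
      using subsetD[OF keys_mult e] by blast
    then have "Poly_Mapping.keys a \<union> Poly_Mapping.keys b \<subseteq> {..<m}" "e = a + b"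
      using * by (auto simp: polys_in_def)
    then show ?thesis using keys_add[of a b] by blast
  qed
  then show ?thesis by (simp add: polys_in_def)
qed

lemma polys_in_of_nat: "of_nat n \<in> polys_in m"
  by (auto simp: polys_in_def in_keys_iff[of _ "of_nat n"] lookup_of_nat when_def split: if_splits)

lemma to_poly_in: "set_pexp p \<subseteq> {..<m} \<Longrightarrow> to_poly p \<in> polys_in m"
  by (induction p) (simp_all add: polys_in_add polys_in_mult polys_in_of_nat, simp add: polys_in_def)

text \<open>A multiple of a variable has no constant term, so that adding \<open>of_nat c\<close>
  makes the constant coefficient exactly \<open>of_nat c\<close>.\<close>

lemma lookup_Var_mult_0:
  "Poly_Mapping.lookup (to_poly (Mul (Var i) p)) 0 = 0"
proof -
  have "0 \<notin> Poly_Mapping.keys (Poly_Mapping.single (Poly_Mapping.single i 1) 1 * to_poly p)"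
  proof
    assume "0 \<in> Poly_Mapping.keys (Poly_Mapping.single (Poly_Mapping.single i 1) 1 * to_poly p)"
    then obtain e :: "nat \<Rightarrow>\<^sub>0 nat" where e: "0 = Poly_Mapping.single i 1 + e"
      using keys_mult by fastforce
    have "Poly_Mapping.lookup (Poly_Mapping.single i 1 + e) i \<noteq> 0" by (simp add: lookup_add)
    then show False using e by simp
  qed
  then show ?thesis by (simp add: in_keys_iff)
qed

section \<open>Transfer of equations between profiles and natural numbers\<close>

lemma profile_nth_of_nat: "profile_nth (of_nat n) i = (if i = 0 then n else 0)"
  by (induction n) (simp_all add: zero_profile.rep_eq one_profile.rep_eq plus_profile.rep_eq)

text \<open>At index 0 the product formula collapses to \<open>p 0 * q 0\<close>, so reading this
  entry commutes with sums and products.\<close>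

lemma profile_nth_0_peval: "profile_nth (peval p e) 0 = peval p (\<lambda>x. profile_nth (e x) 0)"
  by (induction p) (simp_all add: profile_nth_of_nat plus_profile.rep_eq times_profile.rep_eq
      profile_times_def)

lemma peval_of_nat: "peval p (\<lambda>x. of_nat (e x)) = of_nat (peval p e)"
  by (induction p) simp_all

lemma nonzero_terms_of_nat: "0 < n \<Longrightarrow> nonzero_terms (of_nat n) = [n]"
proof -
  assume "0 < n"
  then have "(LEAST i. profile_nth (of_nat n) i = 0) = 1"
    by (intro Least_equality) (auto simp: profile_nth_of_nat Suc_le_eq split: if_splits)
  then show ?thesis by (simp add: nonzero_terms_def profile_nth_of_nat)
qed

text \<open>A solution in profiles is read at index 0, and a solution in natural numbers is embedded
  entry by entry.\<close>

lemma has_solution_iff: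
  assumes "set_pexp p \<subseteq> {..<m}" "set_pexp q \<subseteq> {..<m}"
  shows "has_solution m (of_nat c + to_poly p) (to_poly q) \<longleftrightarrow>
    (\<exists>e. c + peval p e = peval q e)"
proof
  assume "has_solution m (of_nat c + to_poly p) (to_poly q)"
  then obtain xs where xs: "length xs = m" "poly_value (of_nat c + to_poly p) xs = poly_value (to_poly q) xs"
    unfolding has_solution_def by blast
  then have "of_nat c + peval p ((!) xs) = peval q ((!) xs)"
    using assms by (simp add: poly_value_add poly_value_of_nat poly_value_to_poly)
  then have "profile_nth (of_nat c + peval p ((!) xs)) 0 = profile_nth (peval q ((!) xs)) 0" by simp
  then show "\<exists>e. c + peval p e = peval q e"
    by (auto simp: plus_profile.rep_eq profile_nth_0_peval profile_nth_of_nat)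
next
  assume "\<exists>e. c + peval p e = peval q e"
  then obtain e where e: "c + peval p e = peval q e" by blast
  define xs :: "profile list" where "xs = map (\<lambda>i. of_nat (e i)) [0..<m]"
  have xs: "peval r ((!) xs) = of_nat (peval r e)" if "set_pexp r \<subseteq> {..<m}" for r
    unfolding peval_of_nat[symmetric] using that by (intro peval_eq_on) (auto simp: xs_def)
  have "length xs = m" by (simp add: xs_def)
  moreover have "of_nat c + of_nat (peval p e) = (of_nat (peval q e) :: profile)"
    by (simp flip: e)
  ultimately show "has_solution m (of_nat c + to_poly p) (to_poly q)"
    unfolding has_solution_def using assms
    by (intro exI[of _ xs]) (simp add: poly_value_add poly_value_of_nat poly_value_to_poly xs)
qed

section \<open>Equations with a prescribed constant coefficient\<close>

lemma exponent_pos: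
  fixes e :: "nat \<Rightarrow>\<^sub>0 nat"
  assumes "e \<noteq> 0"
  shows "0 < e"
proof -
  have "\<exists>k. Poly_Mapping.lookup e k \<noteq> 0" using assms by (metis lookup_zero poly_mapping_eqI)
  then have "\<exists>k. Poly_Mapping.lookup e k \<noteq> 0 \<and> (\<forall>j<k. Poly_Mapping.lookup e j = 0)"
    by (meson exists_least_iff)
  then show ?thesis by (auto simp: less_poly_mapping.rep_eq less_fun_def)
qed

text \<open>The zero exponent vector is least in the order of the listing, so the constant monomial
  comes first and its coefficient has a fixed place in the encoding.\<close>

lemma items_add_const:
  fixes p :: profile_poly
  assumes "Poly_Mapping.lookup p 0 = 0" "(of_nat c :: profile) \<noteq> 0"
  shows "Poly_Mapping.items (of_nat c + p) = (0, of_nat c) # Poly_Mapping.items p"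
proof -
  have lookup: "Poly_Mapping.lookup (of_nat c + p) e =
      (if e = 0 then of_nat c else Poly_Mapping.lookup p e)" for e
    using assms(1) by (simp add: lookup_add lookup_of_nat)
  then have keys: "Poly_Mapping.keys (of_nat c + p) = insert 0 (Poly_Mapping.keys p)"
    using assms by (auto simp: in_keys_iff split: if_splits)
  have zero: "0 \<notin> Poly_Mapping.keys p" using assms by (simp add: in_keys_iff)
  have "0 < e" if "e \<in> Poly_Mapping.keys p" for e
    using that zero exponent_pos by metis
  then have "insort 0 (sorted_list_of_set (Poly_Mapping.keys p)) =
      0 # sorted_list_of_set (Poly_Mapping.keys p)"
    by (intro insort_is_Cons) (auto intro: less_imp_le)
  then have "sorted_list_of_set (Poly_Mapping.keys (of_nat c + p)) =
      0 # sorted_list_of_set (Poly_Mapping.keys p)"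
    unfolding keys using zero by (simp add: sorted_list_of_set_insert)
  then show ?thesis
    using zero by (auto simp: Poly_Mapping.items_def lookup)
qed

text \<open>The equation says \<open>x * (a - b)^2 = x - c\<close> over the integers. As
  \<open>c > 0\<close>, the right side is below \<open>x\<close>, which forces
  \<open>a = b\<close>.\<close>

lemma nat_pair_equation_iff:
  fixes a b c x :: nat
  assumes "0 < c"
  shows "c + x * (a * a + b * b) = x + 2 * (x * (a * b)) \<longleftrightarrow> a = b \<and> x = c"
proof -
  have "c + x * (a * a + b * b) = x + 2 * (x * (a * b)) \<longleftrightarrow>
      int x * (int a - int b)\<^sup>2 = int x - int c"
    unfolding of_nat_eq_iff[where 'a = int, symmetric]
    by (simp add: power2_eq_square algebra_simps)
  also have "\<dots> \<longleftrightarrow> a = b \<and> x = c"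
  proof
    assume eq: "int x * (int a - int b)\<^sup>2 = int x - int c"
    have "a = b"
    proof (rule ccontr)
      assume "a \<noteq> b"
      then have "1 \<le> (int a - int b)\<^sup>2" by (simp add: int_one_le_iff_zero_less)
      then have "int x * 1 \<le> int x * (int a - int b)\<^sup>2" by (intro mult_left_mono) auto
      then show False using eq assms by simp
    qed
    then show "a = b \<and> x = c" using eq by simp
  qed simp
  finally show ?thesis .
qed

text \<open>
  The parameter of a Diophantine set can be made the constant coefficient of one side: as \<open>c > 0\<close>,
  the equation \<open>c + x (p\<^sup>2 + q\<^sup>2) = x + 2 x p q\<close> is equivalent to \<open>p = q \<and> x = c\<close>.
\<close>

lemma dioph_constant_form:
  assumes "dioph (\<lambda>v. A (v 0))"
  obtains p q :: "nat pexp"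
  where "Poly_Mapping.lookup (to_poly p) 0 = 0"
    and "\<And>c. 0 < c \<Longrightarrow> A c \<longleftrightarrow> (\<exists>e. c + peval p e = peval q e)"
proof -
  obtain p q :: "(nat + nat) pexp" where
    pq: "\<And>v. A (v 0) \<longleftrightarrow> (\<exists>w. peval p (case_sum v w) = peval q (case_sum v w))"
    using assms by (rule diophE) blast
  \<comment> \<open>Parameters become even variables and unknowns odd ones; in particular parameter
    0 is variable 0.\<close>
  define r :: "nat + nat \<Rightarrow> nat" where "r = case_sum (\<lambda>i. 2 * i) (\<lambda>i. Suc (2 * i))"
  have r: "(\<lambda>x. e (r x)) = case_sum (\<lambda>i. e (2 * i)) (\<lambda>i. e (Suc (2 * i)))" for e :: "nat \<Rightarrow> nat"
    by (rule ext) (simp add: r_def split: sum.splits)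
  let ?p = "map_pexp r p" and ?q = "map_pexp r q"
  show thesis
  proof
    show "Poly_Mapping.lookup (to_poly (Mul (Var 0) (Add (Mul ?p ?p) (Mul ?q ?q)))) 0 = 0"
      by (rule lookup_Var_mult_0)
    fix c :: nat
    assume c: "0 < c"
    have "A c \<longleftrightarrow> (\<exists>v :: nat \<Rightarrow> nat. A (v 0) \<and> v 0 = c)" by (auto intro: exI[of _ "\<lambda>_. c"])
    also have "\<dots> \<longleftrightarrow> (\<exists>v w. peval p (case_sum v w) = peval q (case_sum v w) \<and> v 0 = c)"
      by (simp add: pq)
    also have "\<dots> \<longleftrightarrow> (\<exists>e :: nat \<Rightarrow> nat. peval ?p e = peval ?q e \<and> e 0 = c)"
      unfolding peval_map r
      using ex_interleave[of "\<lambda>v w. peval p (case_sum v w) = peval q (case_sum v w) \<and> v 0 = c"] by simp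
    also have "\<dots> \<longleftrightarrow> (\<exists>e. c + peval (Mul (Var 0) (Add (Mul ?p ?p) (Mul ?q ?q))) e =
        peval (Add (Var 0) (Mul (Const 2) (Mul (Var 0) (Mul ?p ?q)))) e)"
      using nat_pair_equation_iff[OF c] by simp
    finally show "A c \<longleftrightarrow> (\<exists>e. c + peval (Mul (Var 0) (Add (Mul ?p ?p) (Mul ?q ?q))) e =
        peval (Add (Var 0) (Mul (Const 2) (Mul (Var 0) (Mul ?p ?q)))) e)" .
  qed
qed

text \<open>Powers of two are used for the number of variables and the constant because their
  numerals can be written down by mere repetition of a symbol.\<close>

lemma binary_power2: "binary (2 ^ n) = Digit True # replicate n (Digit False)"
proof (induction n)
  case 0
  then show ?case by (subst binary.simps) simp
next
  case (Suc n)
  then show ?case by (subst binary.simps) (simp add: replicate_append_same)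
qed

text \<open>What follows the digits of the constant coefficient, and so does not depend on it. The
  replicated zeros are the exponents of the constant monomial.\<close>

definition poly_suffix :: "nat \<Rightarrow> profile_poly \<Rightarrow> profile_poly \<Rightarrow> symbol list" where
  "poly_suffix m p q = [Comma, Bar] @
    encode_nats (replicate m 0) @ [Semicolon] @ encode_poly m p @ encode_poly m q"

lemma encode_equation_add_const:
  assumes "Poly_Mapping.lookup p 0 = 0" "0 < c"
  shows "encode_equation (m, of_nat c + p, q) =
    binary m @ [Comma] @ binary c @ poly_suffix m p q"
proof -
  have "(of_nat c :: profile) \<noteq> 0"
    using assms(2) profile_nth_of_nat[of c 0] by (auto simp: zero_profile.rep_eq)
  then show ?thesis
    using assms
    by (simp add: encode_equation_def encode_poly_def items_add_const encode_monomial_def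
        nonzero_terms_of_nat poly_suffix_def encode_nats_def comp_def map_replicate_const)
qed

definition cons_code :: "nat \<Rightarrow> nat \<Rightarrow> nat" where
  "cons_code d s = Suc (prod_encode (d, s))"

lemma word_code_Cons: "word_code (x # w) = cons_code (symbol_code x) (word_code w)"
  by (simp add: word_code_def cons_code_def)

lemma word_code_replicate:
  "word_code (replicate n x @ w) = (cons_code (symbol_code x) ^^ n) (word_code w)"
  by (induction n) (simp_all add: word_code_Cons)

text \<open>
  The code of \<open>1 0\<^sup>a , 1 0\<^sup>n\<close> followed by a word with code \<open>s\<close>, where \<open>n = prod_encode (a, s)\<close>: the
  number of variables is \<open>2 ^ a\<close> and the constant coefficient is \<open>2 ^ n\<close>.
\<close>

definition instance_code :: "nat \<Rightarrow> nat \<Rightarrow> nat" where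
  "instance_code a s = cons_code 1 ((cons_code 0 ^^ a)
    (cons_code 2 (cons_code 1 ((cons_code 0 ^^ prod_encode (a, s)) s))))"

lemma word_code_equation:
  assumes "Poly_Mapping.lookup p 0 = 0" "s = word_code (poly_suffix (2 ^ a) p q)"
  shows "word_code (encode_equation (2 ^ a,
      of_nat (2 ^ prod_encode (a, s)) + p, q)) = instance_code a s"
  by (subst encode_equation_add_const[OF assms(1)], simp,
      simp add: binary_power2 word_code_Cons word_code_replicate instance_code_def assms(2))

section \<open>A recursive function computing \<open>instance_code\<close>\<close>

lemma computes_Comp1: "computes g xs y \<Longrightarrow> computes f [y] z \<Longrightarrow> computes (Comp f [g]) xs z"
  by (rule computes.intros(4)[of _ _ "[y]"]) simp_all

lemma computes_Comp2:
  "computes g xs y \<Longrightarrow> computes h xs y' \<Longrightarrow> computes f [y, y'] z \<Longrightarrow> computes (Comp f [g, h]) xs z"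
  by (rule computes.intros(4)[of _ _ "[y, y']"]) simp_all

lemma computes_Proj: "i < length xs \<Longrightarrow> xs ! i = y \<Longrightarrow> computes (Proj i) xs y"
  using computes.intros(3) by blast

text \<open>In the step function of \<open>PrimRec\<close>, \<open>Proj 0\<close> is the counter and
  \<open>Proj 1\<close> the value reached so far.\<close>

definition add_recf :: recf where
  "add_recf = PrimRec (Proj 0) (Comp SuccF [Proj 1])"

lemma computes_add: "computes add_recf [m, n] (m + n)"
  unfolding add_recf_def
  by (induction m) (auto intro!: computes.intros(2,5,6) computes_Comp1 computes_Proj)

definition triangle_recf :: recf where
  "triangle_recf = PrimRec ZeroF (Comp add_recf [Proj 1, Comp SuccF [Proj 0]])"

lemma computes_triangle: "computes triangle_recf [n] (triangle n)"
proof (induction n)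
  case 0
  then show ?case unfolding triangle_recf_def by (simp add: computes.intros)
next
  case (Suc n)
  have "computes (Comp add_recf [Proj 1, Comp SuccF [Proj 0]]) [n, triangle n] (triangle n + Suc n)"
    by (rule computes_Comp2[OF _ computes_Comp1 computes_add])
      (auto intro: computes.intros(2) computes_Proj)
  then show ?case using Suc unfolding triangle_recf_def by (simp add: computes.intros(6))
qed

text \<open>Cantor's pairing: \<open>prod_encode (m, n)\<close> is
  \<open>triangle (m + n) + m\<close>.\<close>

definition pair_recf :: recf where
  "pair_recf = Comp add_recf [Comp triangle_recf [add_recf], Proj 0]"

lemma computes_pair: "computes pair_recf [m, n] (prod_encode (m, n))"
  unfolding pair_recf_def prod_encode_def
  by (auto intro!: computes_Comp1 computes_Comp2 computes_add computes_triangle computes_Proj)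

primrec const_recf :: "nat \<Rightarrow> recf" where
  "const_recf 0 = ZeroF"
| "const_recf (Suc n) = Comp SuccF [const_recf n]"

lemma computes_const: "computes (const_recf n) xs n"
  by (induction n) (auto intro: computes.intros(1,2) computes_Comp1)

definition cons_recf :: "nat \<Rightarrow> recf \<Rightarrow> recf" where
  "cons_recf d g = Comp SuccF [Comp pair_recf [const_recf d, g]]"

lemma computes_cons: "computes g xs s \<Longrightarrow> computes (cons_recf d g) xs (cons_code d s)"
  unfolding cons_recf_def cons_code_def
  by (rule computes_Comp1[OF computes_Comp2[OF computes_const _ computes_pair] computes.intros(2)])

definition replicate_recf :: recf where
  "replicate_recf = PrimRec (Proj 0) (cons_recf 0 (Proj 1))"

lemma computes_replicate: "computes replicate_recf [n, s] ((cons_code 0 ^^ n) s)"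
  unfolding replicate_recf_def
  by (induction n) (auto intro!: computes.intros(5,6) computes_cons computes_Proj)

definition instance_recf :: recf where
  "instance_recf = cons_recf 1 (Comp replicate_recf [Proj 0,
    cons_recf 2 (cons_recf 1 (Comp replicate_recf [pair_recf, Proj 1]))])"

lemma computes_instance: "computes instance_recf [a, s] (instance_code a s)"
proof -
  have 1: "computes (Proj 0) [a, s] a" and 2: "computes (Proj 1) [a, s] s"
    by (simp_all add: computes_Proj)
  note 3 = computes_Comp2[OF computes_pair 2 computes_replicate]
  show ?thesis
    unfolding instance_recf_def instance_code_def
    by (rule computes_cons[OF computes_Comp2[OF 1 computes_cons[OF computes_cons[OF 3]] computes_replicate]])
qed

section \<open>The diagonal argument\<close>

theorem theorem7:
  shows "\<not> decidable_problem encode_equation equations (\<lambda>(m, p, q). has_solution m p q)"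
proof
  assume "decidable_problem encode_equation equations (\<lambda>(m, p, q). has_solution m p q)"
  then obtain f where f: "\<And>m p q. (m, p, q) \<in> equations \<Longrightarrow>
      computes f [word_code (encode_equation (m, p, q))] (if has_solution m p q then 1 else 0)"
    unfolding decidable_problem_def by fastforce
  define F where "F = Comp f [instance_recf]"
  \<comment> \<open>\<open>A\<close> holds of the constants that name a pair \<open>(a, s)\<close>
    whose instance \<open>f\<close> rejects.\<close>
  define A where "A c \<longleftrightarrow> (\<exists>a s. c = 2 ^ prod_encode (a, s) \<and> computes F [a, s] 0)" for c :: nat
  have "dioph (\<lambda>v. A (v 0))"
    unfolding A_def prod_encode_def triangle_def prod.case
  \<comment> \<open>Once both quantifiers are opened, place 0 holds \<open>s\<close>, place 1 holds
    \<open>a\<close> and place 2 the parameter \<open>c\<close>.\<close>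
  proof (rule dioph_ex, rule dioph_ex, rule dioph_conj)
    show "dioph (\<lambda>v. v (Suc (Suc 0)) = 2 ^ ((v (Suc 0) + v 0) * Suc (v (Suc 0) + v 0) div 2 + v (Suc 0)))"
      by (rule dioph_eq dfun_power dfun_add dfun_div dfun_mult dfun_Suc dfun_const dfun_var)+
    show "dioph (\<lambda>v. computes F [v (Suc 0), v 0] 0)"
      using dioph_computes[of "[\<lambda>v. v (Suc 0), \<lambda>v. v 0]" "\<lambda>v. 0" F]
      by (simp add: dfun_var dfun_const)
  qed
  then obtain p q :: "nat pexp" where p0: "Poly_Mapping.lookup (to_poly p) 0 = 0"
    and pq: "\<And>c. 0 < c \<Longrightarrow> A c \<longleftrightarrow> (\<exists>e. c + peval p e = peval q e)"
    by (rule dioph_constant_form) blast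
  have "finite (set_pexp p \<union> set_pexp q)" by (simp add: finite_set_pexp)
  \<comment> \<open>A bound \<open>a\<close> on the variables suffices because
    \<open>a < 2 ^ a\<close>.\<close>
  then obtain a where "\<forall>i\<in>set_pexp p \<union> set_pexp q. i < a"
    unfolding finite_nat_set_iff_bounded by blast
  then have vars: "set_pexp p \<subseteq> {..<2 ^ a}" "set_pexp q \<subseteq> {..<2 ^ a}"
    using less_exp less_trans by blast+
  \<comment> \<open>There is no circularity: \<open>s\<close> codes the equation for
    \<open>A\<close> without its constant, and only then is \<open>c\<close> formed from
    \<open>a\<close> and \<open>s\<close>.\<close>
  define s where "s = word_code (poly_suffix (2 ^ a) (to_poly p) (to_poly q))"
  define c :: nat where "c = 2 ^ prod_encode (a, s)"
  define P where "P = of_nat c + to_poly p"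
  have c: "0 < c" by (simp add: c_def)
  have "(2 ^ a, P, to_poly q) \<in> equations"
    using vars by (auto simp: equations_def P_def intro: polys_in_add polys_in_of_nat to_poly_in)
  then have "computes f [word_code (encode_equation (2 ^ a, P, to_poly q))]
      (if has_solution (2 ^ a) P (to_poly q) then 1 else 0)"
    by (rule f)
  then have "computes f [instance_code a s] (if has_solution (2 ^ a) P (to_poly q) then 1 else 0)"
    using word_code_equation[OF p0 s_def] by (simp add: P_def c_def)
  then have F: "computes F [a, s] (if has_solution (2 ^ a) P (to_poly q) then 1 else 0)"
    unfolding F_def by (rule computes_Comp1[OF computes_instance])
  have "has_solution (2 ^ a) P (to_poly q) \<longleftrightarrow> A c"
    unfolding P_def has_solution_iff[OF vars] using pq[OF c] by simp
  \<comment> \<open>Injectivity of powers of 2 and of the pairing recovers \<open>a\<close> and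
    \<open>s\<close> from \<open>c\<close>. Thus a solution exists exactly when \<open>f\<close>
    answers 0, which contradicts its correctness.\<close>
  also have "\<dots> \<longleftrightarrow> computes F [a, s] 0"
    by (simp add: A_def c_def)
  finally show False using F computes_deterministic by (auto split: if_splits)
qed

end
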